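(* Let $C$ be a clock with fixed normalization data $(\iota,\mathfrak a)$. For every timed space $p:X\to C$ and every $u,v\in|X|$, the restriction of the quotient map $q_{u,v}:\overrightarrow{\mathcal P}(X)(u,v)\to\overrightarrow{\mathcal T}(X)(u,v)$ to the subspace $\mathcal N_p(X)(u,v)$ of normalized paths is a homeomorphism $$\mathcal N_p(X)(u,v)\xrightarrow{\ \cong\ }\overrightarrow{\mathcal T}(X)(u,v).$$ The quotient map $q_{u,v}$ is a trivial Hurewicz fibration and, in particular, a trivial q-fibration. If $|X|$ is $\Delta$-Hausdorff, then the trace spaces $\overrightarrow{\mathcal T}(X)(u,v)$ are $\Delta$-Hausdorff as well.
   Context: $\mathbb I=[0,1]$. $\mathbf{Top}$ denotes one of the following two categories (the statement is asserted for each choice): the category of $\Delta$-generated spaces (spaces whose topology is final with respect to all continuous maps from standard topological simplices), or its full subcategory of $\Delta$-Hausdorff spaces ($Y$ is $\Delta$-Hausdorff if the image of every continuous map $\mathbb I\to Y$ is closed). For a topological space $Y$, $k_\Delta Y$ is the same set with the final topology with respect to all continuous maps from standard topological simplices to $Y$. A directed space $X=(|X|,dX)$ consists of a space $|X|\in\mathbf{Top}$ and a set $dX$ of continuous maps $\mathbb I\to|X|$ (directed paths) containing all constant paths and closed under precomposition with continuous nondecreasing maps $\mathbb I\to\mathbb I$ and under normalized composition (concatenation at double speed). A directed map is a continuous map preserving directed paths. $\mathsf{Rep}_+$ is the monoid of continuous nondecreasing surjections $\mathbb I\to\mathbb I$. $X$ is saturated if for every continuous $x:\mathbb I\to|X|$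 and $\phi\in\mathsf{Rep}_+$, $x\circ\phi\in dX$ implies $x\in dX$. A directed map $p$ is regular if, for every directed path $x$, $p\circ x$ constant implies $x$ constant. A clock is a directed space $C$ with $|C|$ submetrizable (admitting a continuous injective map into a metric space). A timed space over $C$ is a regular directed map $p:X\to C$ with $X$ saturated. Paths and traces: $\overrightarrow{\mathcal P}(X)(u,v)=k_\Delta\{x\in dX\mid x(0)=u,\ x(1)=v\}$, the set carrying the relative compact-open topology. Trace equivalence is generated by $x\sim x\circ\phi$, $\phi\in\mathsf{Rep}_+$; $\overrightarrow{\mathcal T}(X)(u,v)$ is the set of classes with the quotient topology of $\overrightarrow{\mathcal P}(X)(u,v)$, and $q_{u,v}$ is the quotient map. Normalization data: a continuous injective map $\iota:|C|\to(M,d)$ into a metric space and a triple $\mathfrak a=((\epsilon_n)_{n\ge1},(w_n)_{n\ge1},\theta)$ with $\epsilon_n>0$, $\epsilon_n\to0$, $w_n>0$, $\sum_nw_n<\infty$, and $\theta:[0,\infty[\to[0,1[$ continuous strictly increasing with $\theta(0)=0$. For a path $y:\mathbb I\to M$, $\epsilon>0$, $t\in\mathbb I$, put $\operatorname{Var}_\epsilon(y,t)=\sup_{0=t_0<\cdots<t_r=t}\sum_{i=1}^r\max(d(y(t_{i-1}),y(t_i))-\epsilon,0)$ (and $\operatorname{Var}_\epsilon(y,0)=0$), and $L_y(t)=\sum_{n\ge1}w_n\theta(\operatorname{Var}_{\epsilon_n}(y,t))$. For a directed path $x$ of $X$, put $\ell_x(t)=L_{\iota\circ p\circ x}(t)$.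 For non-constant $x$, $\ell_x(1)>0$, $\lambda_x=\ell_x/\ell_x(1)\in\mathsf{Rep}_+$ has as fibres exactly the maximal intervals on which $x$ is constant, and $N_p(x)$ is the unique continuous path with $x=N_p(x)\circ\lambda_x$ (it is directed, with the same endpoints as $x$). For constant $x$, $\lambda_x=\mathrm{id}_{\mathbb I}$ and $N_p(x)=x$. Then $\mathcal N_p(X)(u,v)=N_p(\overrightarrow{\mathcal P}(X)(u,v))$ with the relative topology from $\overrightarrow{\mathcal P}(X)(u,v)$. A Hurewicz fibration is a map with the homotopy lifting property with respect to every $Z\in\mathbf{Top}$; it is trivial if it is also a homotopy equivalence. A trivial q-fibration is a map with the right lifting property with respect to $\mathsf S^{n-1}\subset\mathsf D^n$ for all $n\ge0$. *)

theory Defs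
  imports "HOL-Analysis.Analysis" "HOL-Homology.Simplices"
begin

section \<open>Delta-generated and Delta-Hausdorff spaces\<close>

definition kdelta :: "'a topology \<Rightarrow> 'a topology" where
  "kdelta Y = topology (\<lambda>U. U \<subseteq> topspace Y \<and>
     (\<forall>n f. singular_simplex n Y f \<longrightarrow>
        openin (subtopology (powertop_real UNIV) (standard_simplex n))
               {s \<in> standard_simplex n. f s \<in> U}))"

lemma istopology_kdelta:
  "istopology (\<lambda>U. U \<subseteq> topspace Y \<and>
     (\<forall>n f. singular_simplex n Y f \<longrightarrow>
        openin (subtopology (powertop_real UNIV) (standard_simplex n))
               {s \<in> standard_simplex n. f s \<in> U}))"
  (is "istopology (\<lambda>U. U \<subseteq> ?V \<and> ?Q U)")
proof -
  have Int: "{s \<in> D. f s \<in> S \<inter> T} = {s \<in> D. f s \<in> S} \<inter> {s \<in> D. f s \<in> T}"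
    and Union: "{s \<in> D. f s \<in> \<Union>K} = (\<Union>S\<in>K. {s \<in> D. f s \<in> S})"
    for D and f :: "(nat \<Rightarrow> real) \<Rightarrow> 'a" and S T K by auto
  have "S \<inter> T \<subseteq> ?V \<and> ?Q (S \<inter> T)"
    if "S \<subseteq> ?V \<and> ?Q S" "T \<subseteq> ?V \<and> ?Q T" for S T
    unfolding Int using that by (auto simp del: Collect_conj_eq intro: openin_Int)
  moreover have "\<Union>K \<subseteq> ?V \<and> ?Q (\<Union>K)" if "\<forall>S\<in>K. S \<subseteq> ?V \<and> ?Q S" for K
    unfolding Union using that by (auto intro!: openin_Union)
  ultimately show ?thesis
    unfolding istopology_def by simp
qed

lemma openin_kdelta:
  "openin (kdelta Y) U \<longleftrightarrow> U \<subseteq> topspace Y \<and>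
     (\<forall>n f. singular_simplex n Y f \<longrightarrow>
        openin (subtopology (powertop_real UNIV) (standard_simplex n))
               {s \<in> standard_simplex n. f s \<in> U})"
  unfolding kdelta_def using topology_inverse' [OF istopology_kdelta, of Y] by simp

lemma topspace_kdelta [simp]: "topspace (kdelta Y) = topspace Y"
proof -
  have "openin (subtopology (powertop_real UNIV) (standard_simplex n))
               {s \<in> standard_simplex n. f s \<in> topspace Y}" if "singular_simplex n Y f" for n f
    using that openin_continuous_map_preimage [OF _ openin_topspace, of _ Y f]
    by (fastforce simp: singular_simplex_def)
  then have "openin (kdelta Y) (topspace Y)"
    unfolding openin_kdelta by blast
  moreover have "topspace (kdelta Y) \<subseteq> topspace Y"
    using openin_topspace [of "kdelta Y"] unfolding openin_kdelta by (rule conjunct1)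
  ultimately show ?thesis
    using openin_subset by (intro equalityI) blast+
qed

definition delta_generated :: "'a topology \<Rightarrow> bool" where
  "delta_generated Y \<longleftrightarrow> kdelta Y = Y"

definition delta_Hausdorff :: "'a topology \<Rightarrow> bool" where
  "delta_Hausdorff Y \<longleftrightarrow> (\<forall>g. pathin Y g \<longrightarrow> closedin Y (g ` {0..1}))"

text \<open>The two possible choices of the ambient category of spaces.\<close>

datatype top_choice = Delta_Generated | Delta_Hausdorff_Generated

fun in_Top :: "top_choice \<Rightarrow> 'a topology \<Rightarrow> bool" where
  "in_Top Delta_Generated Y \<longleftrightarrow> delta_generated Y"
| "in_Top Delta_Hausdorff_Generated Y \<longleftrightarrow> delta_generated Y \<and> delta_Hausdorff Y"

section \<open>Directed spaces\<close>

text \<open>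
  A map with domain the unit interval is represented by the unique function on the reals that
  restricts to it and is \<^const>\<open>undefined\<close> elsewhere; thus
  \<^term>\<open>compose {0..1} x \<phi>\<close> represents the composite map.
\<close>

definition paths_of :: "'a topology \<Rightarrow> (real \<Rightarrow> 'a) set" where
  "paths_of Y = {x. pathin Y x \<and> x \<in> extensional {0..1}}"

definition monotone_selfmaps :: "(real \<Rightarrow> real) set" where
  "monotone_selfmaps = {\<phi>. continuous_on {0..1} \<phi> \<and> mono_on {0..1} \<phi> \<and> \<phi> ` {0..1} \<subseteq> {0..1}}"

definition Rep_plus :: "(real \<Rightarrow> real) set" where
  "Rep_plus = {\<phi>. continuous_on {0..1} \<phi> \<and> mono_on {0..1} \<phi> \<and> \<phi> ` {0..1} = {0..1}}"

definition ncomp :: "(real \<Rightarrow> 'a) \<Rightarrow> (real \<Rightarrow> 'a) \<Rightarrow> (real \<Rightarrow> 'a)" where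
  "ncomp x y = (\<lambda>t\<in>{0..1}. if t \<le> 1/2 then x (2 * t) else y (2 * t - 1))"

record 'a dspace =
  dtop :: "'a topology"
  dpaths :: "(real \<Rightarrow> 'a) set"

definition directed_space :: "top_choice \<Rightarrow> 'a dspace \<Rightarrow> bool" where
  "directed_space Tc X \<longleftrightarrow>
     in_Top Tc (dtop X) \<and>
     dpaths X \<subseteq> paths_of (dtop X) \<and>
     (\<forall>a \<in> topspace (dtop X). (\<lambda>t\<in>{0..1}. a) \<in> dpaths X) \<and>
     (\<forall>x \<in> dpaths X. \<forall>\<phi> \<in> monotone_selfmaps. compose {0..1} x \<phi> \<in> dpaths X) \<and>
     (\<forall>x \<in> dpaths X. \<forall>y \<in> dpaths X. x 1 = y 0 \<longrightarrow> ncomp x y \<in> dpaths X)"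

definition directed_map :: "'a dspace \<Rightarrow> 'b dspace \<Rightarrow> ('a \<Rightarrow> 'b) \<Rightarrow> bool" where
  "directed_map X Y f \<longleftrightarrow>
     continuous_map (dtop X) (dtop Y) f \<and>
     (\<forall>x \<in> dpaths X. compose {0..1} f x \<in> dpaths Y)"

definition saturated :: "'a dspace \<Rightarrow> bool" where
  "saturated X \<longleftrightarrow>
     (\<forall>x \<in> paths_of (dtop X). \<forall>\<phi> \<in> Rep_plus.
        compose {0..1} x \<phi> \<in> dpaths X \<longrightarrow> x \<in> dpaths X)"

definition regular_map :: "'a dspace \<Rightarrow> 'b dspace \<Rightarrow> ('a \<Rightarrow> 'b) \<Rightarrow> bool" where
  "regular_map X Y p \<longleftrightarrow>
     directed_map X Y p \<and>
     (\<forall>x \<in> dpaths X. (p \<circ> x) constant_on {0..1} \<longrightarrow> x constant_on {0..1})"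

text \<open>
  Requiring the carrier of the metric space to consist of elements of type \<^typ>\<open>'a\<close> is no
  restriction, since the metric can be transported to the image of the injection and then to
  the points of the space.
\<close>

definition submetrizable :: "'a topology \<Rightarrow> bool" where
  "submetrizable Y \<longleftrightarrow>
     (\<exists>(M :: 'a set) d f. Metric_space M d \<and>
        continuous_map Y (Metric_space.mtopology M d) f \<and> inj_on f (topspace Y))"

definition clock :: "top_choice \<Rightarrow> 'c dspace \<Rightarrow> bool" where
  "clock Tc C \<longleftrightarrow> directed_space Tc C \<and> submetrizable (dtop C)"

definition timed_space :: "top_choice \<Rightarrow> 'a dspace \<Rightarrow> 'c dspace \<Rightarrow> ('a \<Rightarrow> 'c) \<Rightarrow> bool" where
  "timed_space Tc X C p \<longleftrightarrow>
     clock Tc C \<and> directed_space Tc X \<and> saturated X \<and> regular_map X C p"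

section \<open>Spaces of directed paths and of traces\<close>

text \<open>
  The subbasis contains the whole set of paths (take \<open>K\<close> empty), so the underlying set of
  the space is \<^term>\<open>paths_of Y\<close>.
\<close>

definition compact_open_paths :: "'a topology \<Rightarrow> (real \<Rightarrow> 'a) topology" where
  "compact_open_paths Y = topology_generated_by
     {{x \<in> paths_of Y. x ` K \<subseteq> U} | K U. compact K \<and> K \<subseteq> {0..1} \<and> openin Y U}"

lemma topspace_compact_open_paths [simp]: "topspace (compact_open_paths Y) = paths_of Y"
proof -
  have "paths_of Y \<in>
      {{x \<in> paths_of Y. x ` K \<subseteq> U} | K U. compact K \<and> K \<subseteq> {0..1} \<and> openin Y U}"
    by (rule CollectI, rule exI[of _ "{}"], rule exI[of _ "{}"]) auto
  then show ?thesis
    unfolding compact_open_paths_def topology_generated_by_topspace by blast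
qed

definition dipath_space :: "'a dspace \<Rightarrow> 'a \<Rightarrow> 'a \<Rightarrow> (real \<Rightarrow> 'a) topology" where
  "dipath_space X u v =
     kdelta (subtopology (compact_open_paths (dtop X)) {x \<in> dpaths X. x 0 = u \<and> x 1 = v})"

definition quotient_topology :: "'a topology \<Rightarrow> ('a \<Rightarrow> 'b) \<Rightarrow> 'b topology" where
  "quotient_topology Y q = topology (\<lambda>U. U \<subseteq> q ` topspace Y \<and> openin Y {x \<in> topspace Y. q x \<in> U})"

lemma istopology_quotient_topology:
  "istopology (\<lambda>U. U \<subseteq> q ` topspace Y \<and> openin Y {x \<in> topspace Y. q x \<in> U})"
  (is "istopology (\<lambda>U. U \<subseteq> ?V \<and> ?Q U)")
proof -
  have Int: "{s \<in> D. q s \<in> S \<inter> T} = {s \<in> D. q s \<in> S} \<inter> {s \<in> D. q s \<in> T}"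
    and Union: "{s \<in> D. q s \<in> \<Union>K} = (\<Union>S\<in>K. {s \<in> D. q s \<in> S})"
    for D S T K by auto
  have "S \<inter> T \<subseteq> ?V \<and> ?Q (S \<inter> T)"
    if "S \<subseteq> ?V \<and> ?Q S" "T \<subseteq> ?V \<and> ?Q T" for S T
    unfolding Int using that by (auto simp del: Collect_conj_eq intro: openin_Int)
  moreover have "\<Union>K \<subseteq> ?V \<and> ?Q (\<Union>K)" if "\<forall>S\<in>K. S \<subseteq> ?V \<and> ?Q S" for K
    unfolding Union using that by (auto intro!: openin_Union)
  ultimately show ?thesis
    unfolding istopology_def by simp
qed

lemma openin_quotient_topology:
  "openin (quotient_topology Y q) U \<longleftrightarrow>
     U \<subseteq> q ` topspace Y \<and> openin Y {x \<in> topspace Y. q x \<in> U}"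
  unfolding quotient_topology_def
  using topology_inverse' [OF istopology_quotient_topology, of q Y] by simp

lemma topspace_quotient_topology [simp]: "topspace (quotient_topology Y q) = q ` topspace Y"
proof -
  have "{x \<in> topspace Y. q x \<in> q ` topspace Y} = topspace Y" by auto
  then have "openin (quotient_topology Y q) (q ` topspace Y)"
    by (simp add: openin_quotient_topology)
  moreover have "topspace (quotient_topology Y q) \<subseteq> q ` topspace Y"
    using openin_topspace [of "quotient_topology Y q"] unfolding openin_quotient_topology by (rule conjunct1)
  ultimately show ?thesis
    using openin_subset by (intro equalityI) blast+
qed

lemma quotient_map_quotient_topology: "quotient_map Y (quotient_topology Y q) q"
  by (simp add: quotient_map_def openin_quotient_topology)

text \<open>
  Trace equivalent directed paths have the same endpoints, so a trace class does not depend on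
  whether the relation is generated on all directed paths or on those from \<open>u\<close> to \<open>v\<close>, and
  \<open>trace_of X\<close> is the quotient map for every choice of endpoints.
\<close>

definition reparam_step :: "'a dspace \<Rightarrow> (real \<Rightarrow> 'a) \<Rightarrow> (real \<Rightarrow> 'a) \<Rightarrow> bool" where
  "reparam_step X x y \<longleftrightarrow> x \<in> dpaths X \<and> (\<exists>\<phi> \<in> Rep_plus. y = compose {0..1} x \<phi>)"

definition trace_of :: "'a dspace \<Rightarrow> (real \<Rightarrow> 'a) \<Rightarrow> (real \<Rightarrow> 'a) set" where
  "trace_of X x = {y. equivclp (reparam_step X) x y}"

definition trace_space :: "'a dspace \<Rightarrow> 'a \<Rightarrow> 'a \<Rightarrow> (real \<Rightarrow> 'a) set topology" where
  "trace_space X u v = quotient_topology (dipath_space X u v) (trace_of X)"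

section \<open>Normalization\<close>

definition normalization_data ::
  "'c dspace \<Rightarrow> 'm set \<Rightarrow> ('m \<Rightarrow> 'm \<Rightarrow> real) \<Rightarrow> ('c \<Rightarrow> 'm) \<Rightarrow>
   (nat \<Rightarrow> real) \<Rightarrow> (nat \<Rightarrow> real) \<Rightarrow> (real \<Rightarrow> real) \<Rightarrow> bool" where
  "normalization_data C M d \<iota> eps w \<theta> \<longleftrightarrow>
     Metric_space M d \<and>
     continuous_map (dtop C) (Metric_space.mtopology M d) \<iota> \<and> inj_on \<iota> (topspace (dtop C)) \<and>
     (\<forall>n\<ge>1. eps n > 0) \<and> eps \<longlonglongrightarrow> 0 \<and>
     (\<forall>n\<ge>1. w n > 0) \<and> summable (\<lambda>n. w (Suc n)) \<and>
     continuous_on {0..} \<theta> \<and> strict_mono_on {0..} \<theta> \<and> \<theta> ` {0..} \<subseteq> {0..<1} \<and> \<theta> 0 = 0"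

text \<open>
  The supremum is a real one: for a continuous path the sums are bounded, because by uniform
  continuity only boundedly many summands are nonzero. For \<open>t = 0\<close> the only subdivision has
  \<open>r = 0\<close> and the value is \<open>0\<close>.
\<close>

definition Var :: "('m \<Rightarrow> 'm \<Rightarrow> real) \<Rightarrow> real \<Rightarrow> (real \<Rightarrow> 'm) \<Rightarrow> real \<Rightarrow> real" where
  "Var d e y t =
     Sup {(\<Sum>i=1..r. max (d (y (s (i - 1))) (y (s i)) - e) 0) | (r :: nat) (s :: nat \<Rightarrow> real).
            s 0 = 0 \<and> s r = t \<and> (\<forall>i\<in>{1..r}. s (i - 1) < s i)}"

definition Lfun ::
  "('m \<Rightarrow> 'm \<Rightarrow> real) \<Rightarrow> (nat \<Rightarrow> real) \<Rightarrow> (nat \<Rightarrow> real) \<Rightarrow> (real \<Rightarrow> real) \<Rightarrow>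
   (real \<Rightarrow> 'm) \<Rightarrow> real \<Rightarrow> real" where
  "Lfun d eps w \<theta> y t = suminf (\<lambda>n. w (Suc n) * \<theta> (Var d (eps (Suc n)) y t))"

definition ell ::
  "('m \<Rightarrow> 'm \<Rightarrow> real) \<Rightarrow> ('c \<Rightarrow> 'm) \<Rightarrow> (nat \<Rightarrow> real) \<Rightarrow> (nat \<Rightarrow> real) \<Rightarrow> (real \<Rightarrow> real) \<Rightarrow>
   ('a \<Rightarrow> 'c) \<Rightarrow> (real \<Rightarrow> 'a) \<Rightarrow> real \<Rightarrow> real" where
  "ell d \<iota> eps w \<theta> p x t = Lfun d eps w \<theta> (\<iota> \<circ> p \<circ> x) t"

definition lam ::
  "('m \<Rightarrow> 'm \<Rightarrow> real) \<Rightarrow> ('c \<Rightarrow> 'm) \<Rightarrow> (nat \<Rightarrow> real) \<Rightarrow> (nat \<Rightarrow> real) \<Rightarrow> (real \<Rightarrow> real) \<Rightarrow>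
   ('a \<Rightarrow> 'c) \<Rightarrow> (real \<Rightarrow> 'a) \<Rightarrow> real \<Rightarrow> real" where
  "lam d \<iota> eps w \<theta> p x =
     (if x constant_on {0..1} then id
      else (\<lambda>t. ell d \<iota> eps w \<theta> p x t / ell d \<iota> eps w \<theta> p x 1))"

definition norm_path ::
  "('m \<Rightarrow> 'm \<Rightarrow> real) \<Rightarrow> ('c \<Rightarrow> 'm) \<Rightarrow> (nat \<Rightarrow> real) \<Rightarrow> (nat \<Rightarrow> real) \<Rightarrow> (real \<Rightarrow> real) \<Rightarrow>
   'a dspace \<Rightarrow> ('a \<Rightarrow> 'c) \<Rightarrow> (real \<Rightarrow> 'a) \<Rightarrow> (real \<Rightarrow> 'a)" where
  "norm_path d \<iota> eps w \<theta> X p x =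
     (if x constant_on {0..1} then x
      else (THE y. y \<in> paths_of (dtop X) \<and> x = compose {0..1} y (lam d \<iota> eps w \<theta> p x)))"

definition normalized_space ::
  "('m \<Rightarrow> 'm \<Rightarrow> real) \<Rightarrow> ('c \<Rightarrow> 'm) \<Rightarrow> (nat \<Rightarrow> real) \<Rightarrow> (nat \<Rightarrow> real) \<Rightarrow> (real \<Rightarrow> real) \<Rightarrow>
   'a dspace \<Rightarrow> ('a \<Rightarrow> 'c) \<Rightarrow> 'a \<Rightarrow> 'a \<Rightarrow> (real \<Rightarrow> 'a) topology" where
  "normalized_space d \<iota> eps w \<theta> X p u v =
     subtopology (dipath_space X u v)
       (norm_path d \<iota> eps w \<theta> X p ` topspace (dipath_space X u v))"

section \<open>Fibrations\<close>

definition Top_map :: "top_choice \<Rightarrow> 'e topology \<Rightarrow> 'b topology \<Rightarrow> ('e \<Rightarrow> 'b) \<Rightarrow> bool" where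
  "Top_map Tc E B q \<longleftrightarrow> in_Top Tc E \<and> in_Top Tc B \<and> continuous_map E B q"

text \<open>
  Cylinders are ordinary products. For a Delta-generated space \<open>Z\<close> the product with the unit
  interval is again Delta-generated, so this is also the product in the category.
\<close>

definition homotopy_lifting :: "'z topology \<Rightarrow> 'e topology \<Rightarrow> 'b topology \<Rightarrow> ('e \<Rightarrow> 'b) \<Rightarrow> bool" where
  "homotopy_lifting Z E B q \<longleftrightarrow>
     (\<forall>f h. continuous_map Z E f \<and>
            continuous_map (prod_topology (top_of_set {0..1::real}) Z) B h \<and>
            (\<forall>z \<in> topspace Z. h (0, z) = q (f z)) \<longrightarrow>
        (\<exists>k. continuous_map (prod_topology (top_of_set {0..1::real}) Z) E k \<and>
             (\<forall>z \<in> topspace Z. k (0, z) = f z) \<and>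
             (\<forall>t \<in> {0..1}. \<forall>z \<in> topspace Z. q (k (t, z)) = h (t, z))))"

text \<open>
  A definition cannot quantify over types: the test spaces \<open>Z\<close> range over all topologies on
  the type \<^typ>\<open>'z\<close>. A theorem with conclusion
  \<open>Hurewicz_fibration Tc TYPE('z) E B q\<close>, in which the type variable occurs nowhere else,
  asserts the lifting property for all test spaces.
\<close>

definition Hurewicz_fibration ::
  "top_choice \<Rightarrow> 'z itself \<Rightarrow> 'e topology \<Rightarrow> 'b topology \<Rightarrow> ('e \<Rightarrow> 'b) \<Rightarrow> bool" where
  "Hurewicz_fibration Tc T E B q \<longleftrightarrow>
     Top_map Tc E B q \<and>
     (\<forall>Z :: 'z topology. in_Top Tc Z \<longrightarrow> homotopy_lifting Z E B q)"

definition homotopy_equivalence :: "'e topology \<Rightarrow> 'b topology \<Rightarrow> ('e \<Rightarrow> 'b) \<Rightarrow> bool" where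
  "homotopy_equivalence E B q \<longleftrightarrow>
     continuous_map E B q \<and>
     (\<exists>g. continuous_map B E g \<and>
          homotopic_with (\<lambda>_. True) E E (g \<circ> q) id \<and>
          homotopic_with (\<lambda>_. True) B B (q \<circ> g) id)"

definition trivial_Hurewicz_fibration ::
  "top_choice \<Rightarrow> 'z itself \<Rightarrow> 'e topology \<Rightarrow> 'b topology \<Rightarrow> ('e \<Rightarrow> 'b) \<Rightarrow> bool" where
  "trivial_Hurewicz_fibration Tc T E B q \<longleftrightarrow>
     Hurewicz_fibration Tc T E B q \<and> homotopy_equivalence E B q"

text \<open>The space \<open>disk_boundary 0\<close> is empty and \<open>disk 0\<close> is a point.\<close>

definition disk :: "nat \<Rightarrow> (nat \<Rightarrow> real) topology" where
  "disk n = subtopology (Euclidean_space n) {x. (\<Sum>i<n. x i ^ 2) \<le> 1}"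

definition disk_boundary :: "nat \<Rightarrow> (nat \<Rightarrow> real) topology" where
  "disk_boundary n = subtopology (Euclidean_space n) {x. (\<Sum>i<n. x i ^ 2) = 1}"

lemma disk_boundary_Suc: "disk_boundary (Suc n) = nsphere n"
  by (simp add: disk_boundary_def nsphere_def lessThan_Suc_atMost)

lemma topspace_disk_boundary_0: "topspace (disk_boundary 0) = {}"
  by (simp add: disk_boundary_def)

definition trivial_q_fibration ::
  "top_choice \<Rightarrow> 'e topology \<Rightarrow> 'b topology \<Rightarrow> ('e \<Rightarrow> 'b) \<Rightarrow> bool" where
  "trivial_q_fibration Tc E B q \<longleftrightarrow>
     Top_map Tc E B q \<and>
     (\<forall>n f h. continuous_map (disk_boundary n) E f \<and> continuous_map (disk n) B h \<and>
              (\<forall>z \<in> topspace (disk_boundary n). q (f z) = h z) \<longrightarrow>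
        (\<exists>k. continuous_map (disk n) E k \<and>
             (\<forall>z \<in> topspace (disk_boundary n). k z = f z) \<and>
             (\<forall>z \<in> topspace (disk n). q (k z) = h z)))"

end

(*
  Var_eps(y, .) is the least function F with F(0) >= 0 whose increment over every [a,b] is at least
  max(d(y a, y b) - eps, 0).  Exhibiting such functions F gives finiteness, invariance under
  reparametrization and joint continuity in (y, t), hence the same for the length l_x(t).  By
  regularity the fibres of l_x are the intervals of constancy of x, so N_p(x) exists; it depends
  only on the trace of x, is continuous in x, and therefore induces a continuous section s of q.

  For the lifting property, let h(0,z) = q(f(z)).  The lift is
  s(h(t,z)) reparametrized by tau |-> ((1-t) l(tau) + t tau) / ((1-t) l(1) + t) with l = l_{f(z)}.
  At t = 0 this is the reparametrization turning N_p(f(z)) back into f(z); at t = 1 it is the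
  identity.  The denominator vanishes only if t = 0 and f(z) is constant, where every
  reparametrization of nearby paths is harmless because their images are small.  With h constant in
  t this is a homotopy from the identity to s q; on the cylinder over a sphere the final stage is
  constant, so the lift factors through the disk.

  Every convergent sequence in a convex subset of a product of lines lies on a path, so the
  topology k_Delta is determined by paths alone.
*)
theory Submission
  imports Defs
begin

section \<open>Epsilon-variation\<close>

text \<open>Ordinary length of a continuous path may be infinite and is only lower semicontinuous
  under uniform convergence. Charging \<open>e\<close> for each increment cures both: by uniform
  continuity only boundedly many summands stay positive, and each changes little under a small
  perturbation. A single threshold does not see motion of small diameter, so all
  \<open>eps (Suc n)\<close> are used; the summable weights and the bound
  \<open>\<theta> < 1\<close> make the series converge uniformly over all paths and times, so
  continuity passes to the sum. Two obstacles shape the rest. Length is measured in the metric space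
  behind the clock, but \<open>p\<close> need not be injective, so continuity of \<open>N\<close>
  with values in paths of \<open>X\<close> cannot be read off there and is checked on compact-open
  conditions. Moreover \<open>kdelta\<close> has no convenient basis, so continuity is proved for
  the compact-open topology and then transferred, which requires a Delta-generated source; hence the
  attention to cylinders and disks.\<close>

definition controls :: "('m \<Rightarrow> 'm \<Rightarrow> real) \<Rightarrow> real \<Rightarrow> (real \<Rightarrow> 'm) \<Rightarrow> real \<Rightarrow> (real \<Rightarrow> real) \<Rightarrow> bool" where
  "controls d e y t F \<longleftrightarrow> 0 \<le> F 0 \<and>
     (\<forall>a b. 0 \<le> a \<and> a < b \<and> b \<le> t \<longrightarrow> F a + max (d (y a) (y b) - e) 0 \<le> F b)"

lemma controlsD:
  "controls d e y t F \<Longrightarrow> 0 \<le> a \<Longrightarrow> a < b \<Longrightarrow> b \<le> t \<Longrightarrow> F a + max (d (y a) (y b) - e) 0 \<le> F b"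
  unfolding controls_def by blast

lemma controls_mono: "controls d e y t F \<Longrightarrow> s \<le> t \<Longrightarrow> controls d e y s F"
  unfolding controls_def by fastforce

definition var_sums :: "('m \<Rightarrow> 'm \<Rightarrow> real) \<Rightarrow> real \<Rightarrow> (real \<Rightarrow> 'm) \<Rightarrow> real \<Rightarrow> real set" where
  "var_sums d e y t =
     {(\<Sum>i=1..r. max (d (y (s (i - 1))) (y (s i)) - e) 0) | (r :: nat) (s :: nat \<Rightarrow> real).
            s 0 = 0 \<and> s r = t \<and> (\<forall>i\<in>{1..r}. s (i - 1) < s i)}"

lemma Var_eq_Sup: "Var d e y t = Sup (var_sums d e y t)"
  unfolding Var_def var_sums_def ..

lemma zero_in_var_sums: "0 \<in> var_sums d e y 0"
  unfolding var_sums_def by (intro CollectI exI[of _ "0::nat"] exI[of _ "\<lambda>_. 0"]) auto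

text \<open>Append \<open>b\<close> as a new last node. This is the superadditivity behind
  \<open>controls_Var\<close>.\<close>

lemma var_sums_extend:
  assumes "S \<in> var_sums d e y a" "a < b"
  shows "S + max (d (y a) (y b) - e) 0 \<in> var_sums d e y b"
proof -
  obtain r :: nat and s :: "nat \<Rightarrow> real" where S: "S = (\<Sum>i=1..r. max (d (y (s (i - 1))) (y (s i)) - e) 0)"
    and s: "s 0 = 0" "s r = a" "\<forall>i\<in>{1..r}. s (i - 1) < s i"
    using assms(1) unfolding var_sums_def by blast
  define s' where "s' = s(Suc r := b)"
  have "S = (\<Sum>i=1..r. max (d (y (s' (i - 1))) (y (s' i)) - e) 0)"
    unfolding S s'_def by (rule sum.cong) auto
  then have "S + max (d (y a) (y b) - e) 0
      = (\<Sum>i=1..Suc r. max (d (y (s' (i - 1))) (y (s' i)) - e) 0)"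
    using s by (simp add: s'_def)
  moreover have "s' 0 = 0" "s' (Suc r) = b" "\<forall>i\<in>{1..Suc r}. s' (i - 1) < s' i"
    using s assms(2) by (auto simp: s'_def le_Suc_eq)
  ultimately show ?thesis
    unfolding var_sums_def by blast
qed

lemma var_sums_nonempty: "0 \<le> t \<Longrightarrow> var_sums d e y t \<noteq> {}"
  using zero_in_var_sums[of d e y] var_sums_extend[OF zero_in_var_sums, of t d y e]
  by (cases "t = 0") auto

text \<open>The defining inequality of \<open>controls\<close> telescopes along the subdivision,
  starting from \<open>0 \<le> F 0\<close>.\<close>

lemma var_sums_le:
  assumes F: "controls d e y t F" and S: "S \<in> var_sums d e y t"
  shows "S \<le> F t"
proof -
  obtain r :: nat and s :: "nat \<Rightarrow> real" where S: "S = (\<Sum>i=1..r. max (d (y (s (i - 1))) (y (s i)) - e) 0)"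
    and s: "s 0 = 0" "s r = t" "\<forall>i\<in>{1..r}. s (i - 1) < s i"
    using S unfolding var_sums_def by blast
  have mono: "s i \<le> s j" if "i \<le> j" "j \<le> r" for i j
    using that
  proof (induction j rule: dec_induct)
    case (step k)
    then show ?case using s(3)[rule_format, of "Suc k"] by auto
  qed simp
  have "(\<Sum>i=1..k. max (d (y (s (i - 1))) (y (s i)) - e) 0) \<le> F (s k)" if "k \<le> r" for k
    using that
  proof (induction k)
    case 0
    then show ?case using F s by (simp add: controls_def)
  next
    case (Suc k)
    have "F (s k) + max (d (y (s k)) (y (s (Suc k))) - e) 0 \<le> F (s (Suc k))"
      using s(3)[rule_format, of "Suc k"] mono[of 0 k] mono[of "Suc k" r] Suc s
      by (intro controlsD[OF F]) auto
    then show ?case using Suc by simp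
  qed
  from this[of r] show ?thesis using S s by simp
qed

lemma Var_le:
  assumes "controls d e y t F" "0 \<le> t"
  shows "Var d e y t \<le> F t"
  unfolding Var_eq_Sup
  using var_sums_le[OF assms(1)] by (intro cSup_least var_sums_nonempty assms) auto

lemma Var_upper:
  assumes "controls d e y t F" "S \<in> var_sums d e y t"
  shows "S \<le> Var d e y t"
  unfolding Var_eq_Sup
  using var_sums_le[OF assms(1)] by (intro cSup_upper assms bdd_aboveI[of _ "F t"]) auto

text \<open>\<open>F\<close> enters as the bound that makes \<open>Sup\<close> a genuine supremum;
  the inequality itself comes from \<open>var_sums_extend\<close>.\<close>

lemma controls_Var:
  assumes F: "controls d e y t F"
  shows "controls d e y t (Var d e y)"
  unfolding controls_def
proof (intro conjI allI impI)
  have "var_sums d e y 0 = {0}"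
  proof -
    have "S = 0" if "S \<in> var_sums d e y 0" for S
    proof -
      have "controls d e y 0 (\<lambda>_. 0)" by (simp add: controls_def)
      then have "S \<le> 0" using var_sums_le that by fastforce
      moreover have "0 \<le> S" using that unfolding var_sums_def by (auto intro: sum_nonneg)
      ultimately show ?thesis by simp
    qed
    then show ?thesis using zero_in_var_sums by fastforce
  qed
  then show "0 \<le> Var d e y 0" by (simp add: Var_eq_Sup)
next
  fix a b :: real
  assume ab: "0 \<le> a \<and> a < b \<and> b \<le> t"
  have "Var d e y a \<le> Var d e y b - max (d (y a) (y b) - e) 0"
    unfolding Var_eq_Sup[of d e y a]
  proof (rule cSup_least)
    show "var_sums d e y a \<noteq> {}" using ab by (intro var_sums_nonempty) auto
    fix S assume "S \<in> var_sums d e y a"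
    then have "S + max (d (y a) (y b) - e) 0 \<in> var_sums d e y b"
      using ab by (intro var_sums_extend) auto
    then have "S + max (d (y a) (y b) - e) 0 \<le> Var d e y b"
      using ab by (intro Var_upper[OF controls_mono[OF F]]) auto
    then show "S \<le> Var d e y b - max (d (y a) (y b) - e) 0" by simp
  qed
  then show "Var d e y a + max (d (y a) (y b) - e) 0 \<le> Var d e y b" by simp
qed

lemma Var_0 [simp]: "Var d e y 0 = 0"
proof (rule antisym)
  have c: "controls d e y 0 (\<lambda>_. 0)" by (simp add: controls_def)
  from Var_le[OF this] show "Var d e y 0 \<le> 0" by simp
  from controls_Var[OF c] show "0 \<le> Var d e y 0" by (simp add: controls_def)
qed

lemma Var_mono:
  assumes F: "controls d e y 1 F" and "0 \<le> s" "s \<le> t" "t \<le> 1"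
  shows "Var d e y s \<le> Var d e y t"
  using controlsD[OF controls_Var[OF F], of s t] assms by (cases "s = t") auto

lemma Var_nonneg:
  assumes "controls d e y 1 F" "0 \<le> t" "t \<le> 1"
  shows "0 \<le> Var d e y t"
  using Var_mono[OF assms(1), of 0 t] assms by simp

text \<open>Each inequality exhibits a control: the pullback of \<open>Var d e y\<close> along
  \<open>\<phi>\<close>, and the pullback of \<open>Var d e x\<close> along a strictly increasing,
  possibly discontinuous, right inverse of \<open>\<phi>\<close>.\<close>

lemma Var_reparam:
  assumes phi: "mono_on {0..1} \<phi>" "\<phi> ` {0..1} = {0..1::real}" and t: "t \<in> {0..1}"
    and F: "controls d e y 1 F" and x: "\<And>s. s \<in> {0..1} \<Longrightarrow> x s = y (\<phi> s)" and e: "0 < e"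
    and diag: "\<And>s. s \<in> {0..1} \<Longrightarrow> d (y s) (y s) = 0"
  shows "Var d e x t = Var d e y (\<phi> t)"
proof (rule antisym)
  note V = controls_Var[OF F]
  have in01: "\<phi> s \<in> {0..1}" if "s \<in> {0..1}" for s using phi(2) that by blast
  have c: "controls d e x 1 (\<lambda>s. Var d e y (\<phi> s))"
    unfolding controls_def
  proof (intro conjI allI impI)
    show "0 \<le> Var d e y (\<phi> 0)" using Var_nonneg[OF F] in01[of 0] by simp
    fix a b :: real assume ab: "0 \<le> a \<and> a < b \<and> b \<le> 1"
    then have le: "\<phi> a \<le> \<phi> b" using phi(1) by (intro mono_onD[OF phi(1)]) auto
    show "Var d e y (\<phi> a) + max (d (x a) (x b) - e) 0 \<le> Var d e y (\<phi> b)"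
    proof (cases "\<phi> a = \<phi> b")
      \<comment> \<open>A stretch collapsed by \<open>\<phi>\<close> contributes
        \<open>max (0 - e) 0 = 0\<close>; this is where \<open>diag\<close> and \<open>0 < e\<close>
        enter.\<close>
      case True
      then show ?thesis using ab e x diag in01[of b] by simp
    next
      case False
      then show ?thesis
        using controlsD[OF V, of "\<phi> a" "\<phi> b"] le ab x in01[of a] in01[of b] by simp
    qed
  qed
  show "Var d e x t \<le> Var d e y (\<phi> t)"
    using Var_le[OF controls_mono[OF c, of t]] t by simp
  \<comment> \<open>Any right inverse of a monotone \<open>\<phi>\<close> is strictly increasing.
    Prescribing the value \<open>t\<close> at \<open>\<phi> t\<close> makes the estimate end at
    \<open>t\<close> itself and not at another point of its fibre.\<close>
  define \<psi> where "\<psi> r = (if r = \<phi> t then t else (SOME s. s \<in> {0..1} \<and> \<phi> s = r))" for r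
  have psi: "\<psi> r \<in> {0..1} \<and> \<phi> (\<psi> r) = r" if "r \<in> {0..1}" for r
  proof (cases "r = \<phi> t")
    case False
    have "\<exists>s. s \<in> {0..1} \<and> \<phi> s = r" using phi(2) that by (metis imageE)
    from someI_ex[OF this] show ?thesis using False by (simp add: \<psi>_def)
  qed (use t in \<open>simp add: \<psi>_def\<close>)
  have psi_less: "\<psi> a < \<psi> b" if "a \<in> {0..1}" "b \<in> {0..1}" "a < b" for a b
  proof (rule ccontr)
    assume "\<not> \<psi> a < \<psi> b"
    then have "\<phi> (\<psi> b) \<le> \<phi> (\<psi> a)"
      using psi[OF that(1)] psi[OF that(2)] by (intro mono_onD[OF phi(1)]) auto
    then show False using psi[OF that(1)] psi[OF that(2)] that(3) by simp
  qed
  have "controls d e y 1 (\<lambda>r. Var d e x (\<psi> r))"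
    unfolding controls_def
  proof (intro conjI allI impI)
    show "0 \<le> Var d e x (\<psi> 0)" using Var_nonneg[OF c] psi[of 0] by simp
    fix a b :: real assume ab: "0 \<le> a \<and> a < b \<and> b \<le> 1"
    then show "Var d e x (\<psi> a) + max (d (y a) (y b) - e) 0 \<le> Var d e x (\<psi> b)"
      using controlsD[OF controls_Var[OF c], of "\<psi> a" "\<psi> b"] psi_less[of a b] psi[of a] psi[of b] x
      by simp
  qed
  from Var_le[OF controls_mono[OF this, of "\<phi> t"]]
  have "Var d e y (\<phi> t) \<le> Var d e x (\<psi> (\<phi> t))"
    using in01[OF t] by simp
  then show "Var d e y (\<phi> t) \<le> Var d e x t" by (simp add: \<psi>_def)
qed

text \<open>Only increments over intervals of length at least \<open>\<eta>\<close> contribute, and \<open>\<delta> / \<eta> * s\<close> pays \<open>\<delta>\<close> for each.\<close>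

lemma controls_perturb:
  assumes F: "controls d e y t F" and "0 < \<eta>" "0 \<le> \<delta>" "t \<le> 1"
    and close: "\<And>a b. 0 \<le> a \<Longrightarrow> a < b \<Longrightarrow> b \<le> 1 \<Longrightarrow> d (y' a) (y' b) \<le> d (y a) (y b) + \<delta>"
    and small: "\<And>a b. 0 \<le> a \<Longrightarrow> a < b \<Longrightarrow> b \<le> 1 \<Longrightarrow> b - a < \<eta> \<Longrightarrow> d (y' a) (y' b) \<le> e"
  shows "controls d e y' t (\<lambda>s. F s + \<delta> / \<eta> * s)"
  unfolding controls_def
proof (intro conjI allI impI)
  show "0 \<le> F 0 + \<delta> / \<eta> * 0" using F by (simp add: controls_def)
  fix a b :: real assume ab: "0 \<le> a \<and> a < b \<and> b \<le> t"
  have 1: "F a + max (d (y a) (y b) - e) 0 \<le> F b" using controlsD[OF F] ab by simp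
  have 2: "\<delta> / \<eta> * b = \<delta> / \<eta> * a + \<delta> / \<eta> * (b - a)"
    by (metis add.commute diff_add_cancel distrib_left)
  have 3: "0 \<le> \<delta> / \<eta> * (b - a)" using ab assms by simp
  show "F a + \<delta> / \<eta> * a + max (d (y' a) (y' b) - e) 0 \<le> F b + \<delta> / \<eta> * b"
  proof (cases "b - a < \<eta>")
    case True
    then have "d (y' a) (y' b) \<le> e" using small ab \<open>t \<le> 1\<close> by simp
    then show ?thesis using 1 2 3 by linarith
  next
    case False
    then have "\<delta> \<le> \<delta> / \<eta> * (b - a)"
      using assms mult_left_mono[of 1 "(b - a) / \<eta>" \<delta>] by simp
    moreover have "d (y' a) (y' b) \<le> d (y a) (y b) + \<delta>" using close ab \<open>t \<le> 1\<close> by simp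
    ultimately show ?thesis using 1 2 3 by linarith
  qed
qed

text \<open>The control being perturbed is \<open>Var d e y\<close> itself; bounding
  \<open>t\<close> by 1 in the correction term makes the estimate uniform in
  \<open>t\<close>.\<close>

lemma Var_perturb:
  assumes F: "controls d e y 1 F" and "0 < \<eta>" "0 \<le> \<delta>" "0 \<le> t" "t \<le> 1"
    and close: "\<And>a b. 0 \<le> a \<Longrightarrow> a < b \<Longrightarrow> b \<le> 1 \<Longrightarrow> d (y' a) (y' b) \<le> d (y a) (y b) + \<delta>"
    and small: "\<And>a b. 0 \<le> a \<Longrightarrow> a < b \<Longrightarrow> b \<le> 1 \<Longrightarrow> b - a < \<eta> \<Longrightarrow> d (y' a) (y' b) \<le> e"
  shows "Var d e y' t \<le> Var d e y t + \<delta> / \<eta>"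
proof -
  have "controls d e y' t (\<lambda>s. Var d e y s + \<delta> / \<eta> * s)"
    by (rule controls_perturb[OF controls_mono[OF controls_Var[OF F]]]) (use assms in auto)
  then have "Var d e y' t \<le> Var d e y t + \<delta> / \<eta> * t"
    using Var_le \<open>0 \<le> t\<close> by fast
  moreover have "\<delta> / \<eta> * t \<le> \<delta> / \<eta>" using assms by (intro mult_left_le) auto
  ultimately show ?thesis by linarith
qed

section \<open>Epsilon-variation of paths in a metric space: finiteness and continuity\<close>

context Metric_space
begin

text \<open>The metric lives on a set and not on a type class instance, so uniform continuity is
  applied to the real function \<open>d (y s) (y t)\<close> on the compact square, whose value at
  \<open>(a,b)\<close> is compared with the zero value at \<open>(a,a)\<close>.\<close>

lemma path_uniform:
  assumes y: "pathin mtopology y" and "0 < e"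
  obtains \<eta> where "0 < \<eta>"
    "\<And>a b. a \<in> {0..1} \<Longrightarrow> b \<in> {0..1} \<Longrightarrow> \<bar>a - b\<bar> < \<eta> \<Longrightarrow> d (y a) (y b) \<le> e"
proof -
  define I where "I = {0..1::real}"
  have yM: "continuous_map (top_of_set I) mtopology y"
    using y by (simp add: pathin_def I_def)
  have "continuous_map (prod_topology (top_of_set I) (top_of_set I)) euclideanreal
      (\<lambda>z. d (y (fst z)) (y (snd z)))"
    using continuous_map_mdist[of "prod_topology (top_of_set I) (top_of_set I)" Self "y \<circ> fst" "y \<circ> snd"]
      continuous_map_compose[OF continuous_map_fst yM, of "top_of_set I"]
      continuous_map_compose[OF continuous_map_snd yM, of "top_of_set I"]
    by (simp add: mtopology_of_def)
  then have "continuous_on (I \<times> I) (\<lambda>z. d (y (fst z)) (y (snd z)))"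
    by simp
  then have "uniformly_continuous_on (I \<times> I) (\<lambda>z. d (y (fst z)) (y (snd z)))"
    by (intro compact_uniformly_continuous compact_Times) (auto simp: I_def)
  from this[unfolded uniformly_continuous_on_def, rule_format, OF \<open>0 < e\<close>]
  obtain \<eta> where \<eta>: "0 < \<eta>" "\<forall>z\<in>I \<times> I. \<forall>z'\<in>I \<times> I. dist z' z < \<eta> \<longrightarrow>
      dist (d (y (fst z')) (y (snd z'))) (d (y (fst z)) (y (snd z))) < e"
    by blast
  have "d (y a) (y b) \<le> e" if "a \<in> I" "b \<in> I" "\<bar>a - b\<bar> < \<eta>" for a b
  proof -
    have "y a \<in> M" using yM that by (auto simp: continuous_map_def)
    then show ?thesis
      using \<eta>(2)[rule_format, of "(a,a)" "(a,b)"] that by (simp add: dist_Pair_Pair dist_real_def abs_minus_commute)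
  qed
  with \<eta>(1) that show ?thesis unfolding I_def by blast
qed

lemma path_mem: "pathin mtopology y \<Longrightarrow> t \<in> {0..1} \<Longrightarrow> y t \<in> M"
  by (auto simp: pathin_def continuous_map_def)

text \<open>The constant path at \<open>y 0\<close> has control 0; viewing \<open>y\<close> as its
  perturbation by the diameter bound \<open>B\<close> yields the control
  \<open>B / \<eta> * s\<close>.\<close>

lemma path_controlled:
  assumes y: "pathin mtopology y" and "0 < e"
  shows "\<exists>F. controls d e y 1 F"
proof -
  obtain \<eta> where \<eta>: "0 < \<eta>"
    "\<And>a b. a \<in> {0..1} \<Longrightarrow> b \<in> {0..1} \<Longrightarrow> \<bar>a - b\<bar> < \<eta> \<Longrightarrow> d (y a) (y b) \<le> e"
    using path_uniform[OF assms] by metis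
  have "compactin mtopology (y ` {0..1})"
    using y image_compactin[of "top_of_set {0..1}" "{0..1}" mtopology y]
    by (simp add: pathin_def compactin_subtopology)
  then have "mbounded (y ` {0..1})" by (rule compactin_imp_mbounded)
  then obtain B where B: "0 < B" "\<And>a b. a \<in> {0..1} \<Longrightarrow> b \<in> {0..1} \<Longrightarrow> d (y a) (y b) \<le> B"
    unfolding mbounded_alt_pos by blast
  have "controls d e (\<lambda>_. y 0) 1 (\<lambda>_. 0)"
    using path_mem[OF y, of 0] \<open>0 < e\<close> by (simp add: controls_def)
  from controls_perturb[OF this \<eta>(1), of B y] show ?thesis
    using B \<eta>(2) path_mem[OF y, of 0] by fastforce
qed

text \<open>The competitor \<open>G\<close> follows \<open>Var\<close> up to \<open>s\<close> and
  then jumps once by \<open>\<delta>\<close>. Increments after \<open>s\<close> cost nothing, being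
  at most \<open>e\<close>; an increment across \<open>s\<close> is split at \<open>s\<close> by the
  triangle inequality, and the part after \<open>s\<close> is paid by the jump.\<close>

lemma Var_modulus:
  assumes y: "pathin mtopology y" and e: "0 < e" and st: "0 \<le> s" "s \<le> t" "t \<le> 1"
    and osc: "\<And>r r'. s \<le> r \<Longrightarrow> r \<le> r' \<Longrightarrow> r' \<le> t \<Longrightarrow> d (y r) (y r') \<le> min e \<delta>"
  shows "Var d e y t \<le> Var d e y s + \<delta>"
proof -
  obtain F where F: "controls d e y 1 F" using path_controlled[OF y e] by blast
  note V = controlsD[OF controls_Var[OF F]]
  define G where "G r = (if r \<le> s then Var d e y r else Var d e y s + \<delta>)" for r
  have "y s \<in> M" using path_mem[OF y] st by simp
  then have \<delta>: "0 \<le> \<delta>" using osc[of s s] st by simp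
  have "controls d e y t G"
    unfolding controls_def
  proof (intro conjI allI impI)
    show "0 \<le> G 0" using st by (simp add: G_def)
    fix a b :: real assume ab: "0 \<le> a \<and> a < b \<and> b \<le> t"
    have M: "y a \<in> M" "y b \<in> M" "y s \<in> M" using path_mem[OF y] ab st by auto
    consider "b \<le> s" | "a \<le> s" "s < b" | "s < a" by linarith
    then show "G a + max (d (y a) (y b) - e) 0 \<le> G b"
    proof cases
      case 1
      then show ?thesis using V[of a b] ab st by (simp add: G_def)
    next
      case 2
      have "d (y a) (y b) \<le> d (y a) (y s) + d (y s) (y b)" using M triangle by blast
      moreover have "d (y s) (y b) \<le> \<delta>" using osc[of s b] 2 ab by simp
      moreover have "Var d e y a + max (d (y a) (y s) - e) 0 \<le> Var d e y s"
        using V[of a s] 2 ab st M e by (cases "a = s") auto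
      ultimately show ?thesis using 2 \<delta> by (simp add: G_def max_def split: if_splits)
    next
      case 3
      then show ?thesis using osc[of a b] ab by (simp add: G_def)
    qed
  qed
  then have "Var d e y t \<le> G t" using Var_le st by fastforce
  also have "\<dots> \<le> Var d e y s + \<delta>" using \<delta> st by (auto simp: G_def)
  finally show ?thesis .
qed

lemma continuous_on_Var:
  assumes y: "pathin mtopology y" and e: "0 < e"
  shows "continuous_on {0..1} (Var d e y)"
  unfolding continuous_on_iff
proof (intro ballI allI impI)
  fix s \<delta> :: real assume s: "s \<in> {0..1}" and \<delta>: "0 < \<delta>"
  obtain F where F: "controls d e y 1 F" using path_controlled[OF y e] by blast
  have "0 < min e (\<delta>/2)" using e \<delta> by simp
  then obtain \<eta> where \<eta>: "0 < \<eta>"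
    "\<And>a b. a \<in> {0..1} \<Longrightarrow> b \<in> {0..1} \<Longrightarrow> \<bar>a - b\<bar> < \<eta> \<Longrightarrow> d (y a) (y b) \<le> min e (\<delta>/2)"
    using path_uniform[OF y] by metis
  have *: "\<bar>Var d e y b - Var d e y a\<bar> \<le> \<delta>/2" if "0 \<le> a" "a \<le> b" "b \<le> 1" "b - a < \<eta>" for a b
  proof -
    have "Var d e y b \<le> Var d e y a + \<delta>/2"
      by (rule Var_modulus[OF y e]) (use that \<eta>(2) in auto)
    moreover have "Var d e y a \<le> Var d e y b" using Var_mono[OF F] that by blast
    ultimately show ?thesis using \<delta> by linarith
  qed
  have "dist (Var d e y t) (Var d e y s) < \<delta>" if "t \<in> {0..1}" "dist t s < \<eta>" for t
    using *[of s t] *[of t s] that s \<delta> by (cases "s \<le> t") (auto simp: dist_real_def abs_minus_commute)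
  then show "\<exists>\<eta>>0. \<forall>t\<in>{0..1}. dist t s < \<eta> \<longrightarrow> dist (Var d e y t) (Var d e y s) < \<delta>"
    using \<eta>(1) by blast
qed

lemma Var_uniformly_close:
  assumes y: "pathin mtopology y" and e: "0 < e" and \<epsilon>: "0 < \<epsilon>"
  obtains \<delta> where "0 < \<delta>"
    "\<And>y' t. pathin mtopology y' \<Longrightarrow> (\<And>s. s \<in> {0..1} \<Longrightarrow> d (y s) (y' s) < \<delta>) \<Longrightarrow> t \<in> {0..1} \<Longrightarrow>
       \<bar>Var d e y' t - Var d e y t\<bar> \<le> \<epsilon>"
proof -
  have "0 < e/2" using e by simp
  then obtain \<eta> where \<eta>: "0 < \<eta>"
    "\<And>a b. a \<in> {0..1} \<Longrightarrow> b \<in> {0..1} \<Longrightarrow> \<bar>a - b\<bar> < \<eta> \<Longrightarrow> d (y a) (y b) \<le> e/2"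
    using path_uniform[OF y] by metis
  \<comment> \<open>The bound \<open>e/4\<close> keeps short increments of \<open>y'\<close> at most
    \<open>e/2 + 2 * \<delta> \<le> e\<close>; the bound \<open>\<epsilon> * \<eta> / 2\<close>
    makes the accumulated error \<open>2 * \<delta> / \<eta>\<close> at most
    \<open>\<epsilon>\<close>.\<close>
  define \<delta> where "\<delta> = min (e/4) (\<epsilon> * \<eta> / 2)"
  have \<delta>: "0 < \<delta>" "2 * \<delta> / \<eta> \<le> \<epsilon>" "2 * \<delta> \<le> e/2"
    using e \<epsilon> \<eta> by (auto simp: \<delta>_def field_simps min_def)
  have "\<bar>Var d e y' t - Var d e y t\<bar> \<le> \<epsilon>"
    if y': "pathin mtopology y'" and close: "\<And>s. s \<in> {0..1} \<Longrightarrow> d (y s) (y' s) < \<delta>"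
      and t: "t \<in> {0..1}" for y' t
  proof -
    obtain F where F: "controls d e y 1 F" using path_controlled[OF y e] by blast
    obtain F' where F': "controls d e y' 1 F'" using path_controlled[OF y' e] by blast
    have dd: "\<bar>d (y' a) (y' b) - d (y a) (y b)\<bar> \<le> 2 * \<delta>" if "a \<in> {0..1}" "b \<in> {0..1}" for a b
    proof -
      have M: "y a \<in> M" "y b \<in> M" "y' a \<in> M" "y' b \<in> M" using path_mem y y' that by auto
      have "d (y' a) (y' b) \<le> d (y' a) (y a) + d (y a) (y' b)" using M triangle by blast
      moreover have "d (y a) (y' b) \<le> d (y a) (y b) + d (y b) (y' b)" using M triangle by blast
      moreover have "d (y a) (y b) \<le> d (y a) (y' a) + d (y' a) (y b)" using M triangle by blast
      moreover have "d (y' a) (y b) \<le> d (y' a) (y' b) + d (y' b) (y b)" using M triangle by blast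
      ultimately show ?thesis
        using close[OF that(1)] close[OF that(2)] commute[of "y a" "y' a"] commute[of "y b" "y' b"]
        by linarith
    qed
    have small: "d (y a) (y b) \<le> e/2" if "0 \<le> a" "a < b" "b \<le> 1" "b - a < \<eta>" for a b
      using that by (intro \<eta>(2)) auto
    have "Var d e y' t \<le> Var d e y t + 2 * \<delta> / \<eta>"
    proof (rule Var_perturb[OF F \<eta>(1)])
      fix a b :: real assume ab: "0 \<le> a" "a < b" "b \<le> 1"
      show "d (y' a) (y' b) \<le> d (y a) (y b) + 2 * \<delta>" using dd[of a b] ab by auto
      assume "b - a < \<eta>"
      then show "d (y' a) (y' b) \<le> e" using small[of a b] dd[of a b] ab \<delta> by auto
    qed (use \<delta> t in auto)
    moreover have "Var d e y t \<le> Var d e y' t + 2 * \<delta> / \<eta>"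
    proof (rule Var_perturb[OF F' \<eta>(1)])
      fix a b :: real assume ab: "0 \<le> a" "a < b" "b \<le> 1"
      show "d (y a) (y b) \<le> d (y' a) (y' b) + 2 * \<delta>" using dd[of a b] ab by auto
      assume "b - a < \<eta>"
      then show "d (y a) (y b) \<le> e" using small[of a b] ab \<delta> by auto
    qed (use \<delta> t in auto)
    ultimately show ?thesis using \<delta> by linarith
  qed
  with \<delta>(1) that show ?thesis by blast
qed

end

section \<open>The Delta-generated topology is detected by paths\<close>

abbreviation II :: "real topology" where "II \<equiv> top_of_set {0..1}"

text \<open>The hypothesis is convergence in the product topology at a fixed rate: stage
  \<open>k\<close> controls only the coordinates up to \<open>k\<close>. The last conclusion keeps
  the path inside every convex set containing \<open>s\<close> and the sequence.\<close>

lemma path_through_sequence: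
  fixes \<sigma> :: "nat \<Rightarrow> nat \<Rightarrow> real" and s :: "nat \<Rightarrow> real"
  assumes close: "\<And>k i. i \<le> k \<Longrightarrow> \<bar>\<sigma> k i - s i\<bar> \<le> (1/2) ^ k"
  obtains g :: "real \<Rightarrow> nat \<Rightarrow> real"
  where "\<And>i. continuous_on UNIV (\<lambda>t. g t i)" "g 0 = s" "\<And>k. g ((1/2) ^ k) = \<sigma> k"
    "\<And>t. g t = s \<or> (\<exists>k. \<exists>c\<in>{0..1}. g t = (\<lambda>i. (1 - c) * s i + c * \<sigma> k i))"
proof -
  \<comment> \<open>tents around the points \<open>1 / 2 ^ k\<close>, chosen narrow enough to have disjoint supports\<close>
  define \<tau> where "\<tau> k t = max 0 (1 - 4 * 2 ^ k * \<bar>t - (1/2) ^ k\<bar>)" for k :: nat and t :: real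
  have \<tau>01: "0 \<le> \<tau> k t" "\<tau> k t \<le> 1" for k t by (auto simp: \<tau>_def)
  have supp: "3/4 * (1/2) ^ k < t \<and> t < 5/4 * (1/2) ^ k" if "\<tau> k t \<noteq> 0" for k t
  proof -
    have "4 * 2 ^ k * \<bar>t - (1/2) ^ k\<bar> < 1" using that by (auto simp: \<tau>_def max_def split: if_splits)
    then have "\<bar>t - (1/2) ^ k\<bar> < 1/4 * (1/2) ^ k" by (simp add: field_simps power_divide)
    then show ?thesis by linarith
  qed
  have disj: "j = k" if "\<tau> j t \<noteq> 0" "\<tau> k t \<noteq> 0" for j k t
  proof -
    have False if "\<tau> j t \<noteq> 0" "\<tau> k t \<noteq> 0" "j < k" for j k
    proof -
      \<comment> \<open>Disjointness of the supports comes down to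
        \<open>5/4 * 1/2 < 3/4\<close>.\<close>
      have "(1/2::real) ^ k \<le> (1/2) ^ Suc j" using that(3) by (intro power_decreasing) auto
      moreover have "3/4 * (1/2) ^ j < t" "t < 5/4 * (1/2) ^ k" using supp that by blast+
      moreover have "0 < (1/2::real) ^ j" by simp
      ultimately show False by simp
    qed
    then show ?thesis using that by (meson linorder_neqE_nat)
  qed
  define g where "g t i = s i + suminf (\<lambda>k. \<tau> k t * (\<sigma> k i - s i))" for t i
  have g_at: "g t = (\<lambda>i. s i + \<tau> k t * (\<sigma> k i - s i))" if "\<tau> k t \<noteq> 0" for k t
  proof
    fix i
    have "suminf (\<lambda>j. \<tau> j t * (\<sigma> j i - s i)) = (\<Sum>j\<in>{k}. \<tau> j t * (\<sigma> j i - s i))"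
      by (rule suminf_finite) (use disj[OF that] in auto)
    then show "g t i = s i + \<tau> k t * (\<sigma> k i - s i)" by (simp add: g_def)
  qed
  have g_off: "g t = s" if "\<And>k. \<tau> k t = 0" for t using that by (auto simp: g_def)
  have "\<tau> k 0 = 0" for k by (simp add: \<tau>_def power_divide)
  then have "g 0 = s" using g_off by blast
  moreover have "g ((1/2) ^ k) = \<sigma> k" for k
    using g_at[of k "(1/2) ^ k"] by (simp add: \<tau>_def)
  moreover have "g t = s \<or> (\<exists>k. \<exists>c\<in>{0..1}. g t = (\<lambda>i. (1 - c) * s i + c * \<sigma> k i))" for t
  proof (cases "\<exists>k. \<tau> k t \<noteq> 0")
    case True
    then obtain k where "\<tau> k t \<noteq> 0" by blast
    from g_at[OF this] have "g t = (\<lambda>i. (1 - \<tau> k t) * s i + \<tau> k t * \<sigma> k i)"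
      by (simp add: algebra_simps)
    then show ?thesis
      by (intro disjI2 exI[of _ k] bexI[of _ "\<tau> k t"]) (simp_all add: \<tau>01)
  qed (use g_off in blast)
  moreover have "continuous_on UNIV (\<lambda>t. g t i)" for i
  proof -
    \<comment> \<open>At coordinate \<open>i\<close> the first \<open>i\<close> terms escape the
      hypothesis; being finitely many, they are majorized by their own size.\<close>
    define M where "M k = (if k < i then \<bar>\<sigma> k i - s i\<bar> else (1/2) ^ k)" for k
    have "summable (\<lambda>k. (1/2::real) ^ k)" by (intro summable_geometric) auto
    then have "summable M"
      by (subst summable_cong[of _ "\<lambda>k. (1/2) ^ k"])
        (auto simp: M_def eventually_at_top_linorder intro!: exI[of _ i])
    moreover have "norm (\<tau> k t * (\<sigma> k i - s i)) \<le> M k" for k t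
    proof -
      have "\<bar>\<tau> k t * (\<sigma> k i - s i)\<bar> \<le> \<bar>\<sigma> k i - s i\<bar>"
        unfolding abs_mult using \<tau>01[of k t] by (intro mult_left_le_one_le) auto
      then show ?thesis using close[of i k] by (auto simp: M_def)
    qed
    ultimately have "uniform_limit UNIV (\<lambda>n t. \<Sum>k<n. \<tau> k t * (\<sigma> k i - s i))
        (\<lambda>t. suminf (\<lambda>k. \<tau> k t * (\<sigma> k i - s i))) sequentially"
      by (intro Weierstrass_m_test[of _ _ M]) auto
    then have "continuous_on UNIV (\<lambda>t. suminf (\<lambda>k. \<tau> k t * (\<sigma> k i - s i)))"
      by (rule uniform_limit_theorem[rotated])
        (auto simp: \<tau>_def intro!: always_eventually continuous_intros)
    then show ?thesis unfolding g_def by (intro continuous_intros)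
  qed
  ultimately show ?thesis using that by blast
qed

text \<open>A point \<open>x\<close> of \<open>U\<close> without a neighbourhood inside
  \<open>U\<close> yields points of \<open>V k\<close> outside \<open>U\<close>. On the path through
  them the preimage of \<open>U\<close> is a neighbourhood of 0 and must contain some
  \<open>(1/2) ^ k\<close>, a contradiction.\<close>

lemma openin_convex_path_test:
  fixes S :: "(nat \<Rightarrow> real) set"
  assumes convex: "\<And>x y c. x \<in> S \<Longrightarrow> y \<in> S \<Longrightarrow> c \<in> {0..1} \<Longrightarrow> (\<lambda>i. (1 - c) * x i + c * y i) \<in> S"
    and "U \<subseteq> S"
    and test: "\<And>g. pathin (top_of_set S) g \<Longrightarrow> openin II {t \<in> {0..1}. g t \<in> U}"
  shows "openin (top_of_set S) U"
proof (subst openin_subopen, intro ballI)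
  fix x assume "x \<in> U"
  define V where "V k = S \<inter> (\<Inter>i\<in>{..k}. {y. \<bar>y i - x i\<bar> < (1/2) ^ k})" for k :: nat
  have V: "openin (top_of_set S) (V k)" "x \<in> V k" for k
  proof -
    have "open {y :: nat \<Rightarrow> real. \<bar>y i - x i\<bar> < (1/2) ^ k}" for i
      by (intro open_Collect_less continuous_intros) (auto intro: continuous_on_product_coordinates)
    then have "open (\<Inter>i\<in>{..k}. {y :: nat \<Rightarrow> real. \<bar>y i - x i\<bar> < (1/2) ^ k})"
      by (intro open_INT) auto
    then show "openin (top_of_set S) (V k)" unfolding V_def by (simp add: openin_open_Int)
    show "x \<in> V k" using \<open>x \<in> U\<close> \<open>U \<subseteq> S\<close> by (auto simp: V_def)
  qed
  show "\<exists>T. openin (top_of_set S) T \<and> x \<in> T \<and> T \<subseteq> U"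
  proof (rule ccontr)
    assume no: "\<not> ?thesis"
    have "\<exists>y. y \<in> V k - U" for k using no V[of k] by blast
    then obtain \<sigma> where \<sigma>: "\<And>k. \<sigma> k \<in> V k - U" by metis
    have "\<bar>\<sigma> k i - x i\<bar> \<le> (1/2) ^ k" if "i \<le> k" for k i
    proof -
      have "\<sigma> k \<in> {y. \<bar>y i - x i\<bar> < (1/2) ^ k}"
        using \<sigma>[of k] that unfolding V_def by blast
      then show ?thesis by (simp only: mem_Collect_eq less_imp_le)
    qed
    then obtain g :: "real \<Rightarrow> nat \<Rightarrow> real" where g: "\<And>i. continuous_on UNIV (\<lambda>t. g t i)" "g 0 = x"
      "\<And>k. g ((1/2) ^ k) = \<sigma> k"
      "\<And>t. g t = x \<or> (\<exists>k. \<exists>c\<in>{0..1}. g t = (\<lambda>i. (1 - c) * x i + c * \<sigma> k i))"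
      by (rule path_through_sequence[of \<sigma> x]) (assumption | rule that)+
    have xS: "x \<in> S" and \<sigma>S: "\<sigma> k \<in> S" for k
      using \<open>x \<in> U\<close> \<open>U \<subseteq> S\<close> \<sigma>[of k] by (auto simp: V_def)
    have gS: "g t \<in> S" for t
      using g(4)[of t]
    proof (elim disjE exE bexE)
      fix k c assume "c \<in> {0..1::real}" "g t = (\<lambda>i. (1 - c) * x i + c * \<sigma> k i)"
      then show ?thesis using convex[OF xS \<sigma>S] by simp
    qed (simp add: xS)
    have "continuous_on UNIV g" using g(1) by (rule continuous_on_coordinatewise_then_product)
    then have "pathin (top_of_set S) g"
      unfolding pathin_def using gS by (auto intro: continuous_on_subset)
    from test[OF this] have "openin II {t \<in> {0..1}. g t \<in> U}" .
    moreover have "0 \<in> {t \<in> {0..1}. g t \<in> U}" using g(2) \<open>x \<in> U\<close> by simp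
    ultimately obtain \<epsilon> where \<epsilon>: "0 < \<epsilon>" "ball 0 \<epsilon> \<inter> {0..1} \<subseteq> {t \<in> {0..1}. g t \<in> U}"
      by (meson openin_contains_ball)
    obtain k where k: "(1/2::real) ^ k < \<epsilon>" using real_arch_pow_inv[of \<epsilon> "1/2"] \<epsilon>(1) by auto
    have "(1/2::real) ^ k \<in> ball 0 \<epsilon> \<inter> {0..1}" using k by (auto simp: power_le_one)
    then have "\<sigma> k \<in> U" using \<epsilon>(2) g(3) by fastforce
    then show False using \<sigma>[of k] by blast
  qed
qed

lemma powertop_real_eq_euclidean: "powertop_real UNIV = (euclidean :: (nat \<Rightarrow> real) topology)"
  by (simp add: euclidean_product_topology)

text \<open>One direction uses only simplices of dimension 1, reparametrized as paths; the other
  pulls \<open>U\<close> back to a simplex and applies the path test there, simplices being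
  convex.\<close>

lemma openin_kdelta_path:
  "openin (kdelta Y) U \<longleftrightarrow>
     U \<subseteq> topspace Y \<and> (\<forall>g. pathin Y g \<longrightarrow> openin II {t \<in> {0..1}. g t \<in> U})"
proof (intro iffI conjI allI impI)
  assume U: "openin (kdelta Y) U"
  then show "U \<subseteq> topspace Y" by (simp add: openin_kdelta)
  fix g assume g: "pathin Y g"
  let ?D = "standard_simplex 1"
  define f where "f = restrict (\<lambda>x. g (x 0)) ?D"
  have "continuous_map (top_of_set ?D) II (\<lambda>x. x 0)"
    by (auto simp: standard_simplex_def intro: continuous_on_subset[OF continuous_on_product_coordinates])
  then have "continuous_map (top_of_set ?D) Y (g \<circ> (\<lambda>x. x 0))"
    using g unfolding pathin_def by (rule continuous_map_compose)
  then have "continuous_map (top_of_set ?D) Y f"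
    by (rule continuous_map_eq) (simp add: f_def)
  then have "singular_simplex 1 Y f"
    by (simp add: singular_simplex_def powertop_real_eq_euclidean f_def)
  then have o: "openin (top_of_set ?D) {s \<in> ?D. f s \<in> U}"
    using U by (simp add: openin_kdelta powertop_real_eq_euclidean)
  \<comment> \<open>Inverse of the coordinate \<open>x 0\<close>: it parametrizes the standard
    1-simplex by the interval.\<close>
  define e :: "real \<Rightarrow> nat \<Rightarrow> real" where "e t i = (if i = 0 then t else if i = 1 then 1 - t else 0)" for t i
  have eD: "e t \<in> ?D" if "t \<in> {0..1}" for t
    using that by (auto simp: e_def standard_simplex_def)
  have "continuous_on {0..1} (\<lambda>t. e t i)" for i
    by (cases "i = 0"; cases "i = 1") (auto simp: e_def intro!: continuous_intros)
  then have "continuous_on {0..1} e"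
    by (rule continuous_on_coordinatewise_then_product)
  then have "continuous_map II (top_of_set ?D) e" using eD by auto
  from openin_continuous_map_preimage[OF this o]
  have "openin II {t \<in> {0..1}. e t \<in> {s \<in> ?D. f s \<in> U}}" by simp
  moreover have "{t \<in> {0..1}. e t \<in> {s \<in> ?D. f s \<in> U}} = {t \<in> {0..1}. g t \<in> U}"
    using eD by (auto simp: f_def) (auto simp: e_def)
  ultimately show "openin II {t \<in> {0..1}. g t \<in> U}" by simp
next
  assume U: "U \<subseteq> topspace Y \<and> (\<forall>g. pathin Y g \<longrightarrow> openin II {t \<in> {0..1}. g t \<in> U})"
  show "openin (kdelta Y) U"
    unfolding openin_kdelta powertop_real_eq_euclidean
  proof (intro conjI allI impI)
    show "U \<subseteq> topspace Y" using U by simp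
    fix n f assume "singular_simplex n Y f"
    then have f: "continuous_map (top_of_set (standard_simplex n)) Y f"
      by (simp add: singular_simplex_def powertop_real_eq_euclidean)
    show "openin (top_of_set (standard_simplex n)) {s \<in> standard_simplex n. f s \<in> U}"
    proof (rule openin_convex_path_test)
      fix g assume g: "pathin (top_of_set (standard_simplex n)) g"
      then have "pathin Y (f \<circ> g)" using f by (rule pathin_compose)
      then have "openin II {t \<in> {0..1}. (f \<circ> g) t \<in> U}" using U by blast
      moreover have "g t \<in> standard_simplex n" if "t \<in> {0..1}" for t
        using g that by (auto simp: pathin_def continuous_map_def)
      ultimately show "openin II {t \<in> {0..1}. g t \<in> {s \<in> standard_simplex n. f s \<in> U}}"
        by (simp cong: conj_cong)
    qed (auto intro: convex_standard_simplex)
  qed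
qed

lemma openin_imp_openin_kdelta: "openin Y U \<Longrightarrow> openin (kdelta Y) U"
  unfolding openin_kdelta_path
  using openin_continuous_map_preimage[of II Y _ U] by (auto simp: pathin_def dest: openin_subset)

lemma pathin_kdelta [simp]: "pathin (kdelta Y) g \<longleftrightarrow> pathin Y g"
proof
  assume "pathin (kdelta Y) g"
  then show "pathin Y g"
    by (auto simp: pathin_def continuous_map_def openin_imp_openin_kdelta)
next
  assume "pathin Y g"
  then show "pathin (kdelta Y) g"
    using openin_kdelta_path[of Y] by (auto simp: pathin_def continuous_map_def)
qed

lemma kdelta_kdelta [simp]: "kdelta (kdelta Y) = kdelta Y"
  by (simp add: topology_eq openin_kdelta_path)

lemma delta_generated_kdelta [simp]: "delta_generated (kdelta Y)"
  by (simp add: delta_generated_def)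

lemma delta_generated_path_test:
  "delta_generated Y \<longleftrightarrow>
     (\<forall>U. U \<subseteq> topspace Y \<and> (\<forall>g. pathin Y g \<longrightarrow> openin II {t \<in> {0..1}. g t \<in> U}) \<longrightarrow> openin Y U)"
  unfolding delta_generated_def topology_eq openin_kdelta_path
  using openin_imp_openin_kdelta[of Y] openin_kdelta_path[of Y] by blast

lemma continuous_map_kdelta_id: "continuous_map (kdelta Y) Y id"
  by (simp add: continuous_map_alt openin_imp_openin_kdelta inf.absorb1 openin_subset)

text \<open>Universal property of the coreflection: paths in \<open>Z\<close> map to paths in
  \<open>Y\<close>, and openness in both \<open>Z\<close> and \<open>kdelta Y\<close> is tested on
  paths.\<close>

lemma continuous_map_into_kdelta:
  assumes Z: "delta_generated Z" and f: "continuous_map Z Y f"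
  shows "continuous_map Z (kdelta Y) f"
  unfolding continuous_map_def
proof (intro conjI allI impI)
  show "f \<in> topspace Z \<rightarrow> topspace (kdelta Y)" using f by (simp add: continuous_map_def)
  fix U assume U: "openin (kdelta Y) U"
  show "openin Z {x \<in> topspace Z. f x \<in> U}"
    using Z unfolding delta_generated_path_test
  proof (elim allE impE conjE, intro conjI allI impI)
    fix g assume g: "pathin Z g"
    then have "pathin Y (f \<circ> g)" using f by (rule pathin_compose)
    then have "openin II {t \<in> {0..1}. (f \<circ> g) t \<in> U}"
      using U unfolding openin_kdelta_path by blast
    moreover have "{t \<in> {0..1}. (f \<circ> g) t \<in> U} = {t \<in> {0..1}. g t \<in> {x \<in> topspace Z. f x \<in> U}}"
      using g by (auto simp: pathin_def continuous_map_def)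
    ultimately show "openin II {t \<in> {0..1}. g t \<in> {x \<in> topspace Z. f x \<in> U}}" by simp
  qed auto
qed

lemma continuous_map_kdelta:
  assumes "continuous_map Y Y' f" shows "continuous_map (kdelta Y) (kdelta Y') f"
  using continuous_map_into_kdelta[OF delta_generated_kdelta]
    continuous_map_compose[OF continuous_map_kdelta_id assms] by simp

lemma delta_generated_quotient_topology:
  assumes Y: "delta_generated Y"
  shows "delta_generated (quotient_topology Y q)"
  unfolding delta_generated_path_test
proof (intro allI impI)
  fix U assume U: "U \<subseteq> topspace (quotient_topology Y q) \<and>
    (\<forall>g. pathin (quotient_topology Y q) g \<longrightarrow> openin II {t \<in> {0..1}. g t \<in> U})"
  have q: "continuous_map Y (quotient_topology Y q) q"
    by (simp add: quotient_imp_continuous_map quotient_map_quotient_topology)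
  have "openin Y {x \<in> topspace Y. q x \<in> U}"
    using Y unfolding delta_generated_path_test
  proof (elim allE impE conjE, intro conjI allI impI)
    fix g assume g: "pathin Y g"
    then have "openin II {t \<in> {0..1}. (q \<circ> g) t \<in> U}"
      using U pathin_compose[OF g q] by blast
    moreover have "{t \<in> {0..1}. (q \<circ> g) t \<in> U} = {t \<in> {0..1}. g t \<in> {x \<in> topspace Y. q x \<in> U}}"
      using g by (auto simp: pathin_def continuous_map_def)
    ultimately show "openin II {t \<in> {0..1}. g t \<in> {x \<in> topspace Y. q x \<in> U}}" by simp
  qed auto
  then show "openin (quotient_topology Y q) U"
    using U by (simp add: openin_quotient_topology)
qed

section \<open>Path preimages, the square, products with the interval, and separation of
  paths\<close>

lemma openin_path_preimage: "pathin Y g \<Longrightarrow> openin Y U \<Longrightarrow> openin II {t \<in> {0..1}. g t \<in> U}"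
  using openin_continuous_map_preimage[of II Y g U] by (simp add: pathin_def)

lemma path_mem_topspace: "pathin Y g \<Longrightarrow> t \<in> {0..1} \<Longrightarrow> g t \<in> topspace Y"
  by (auto simp: pathin_def continuous_map_def)

lemma openin_II_cball:
  assumes "openin II U" "t \<in> U"
  obtains \<epsilon> where "0 < \<epsilon>" "cball t \<epsilon> \<inter> {0..1} \<subseteq> U"
  using assms openin_contains_cball by metis

lemma openin_II_ball: "openin II (ball t \<epsilon> \<inter> {0..1})"
  by (metis inf_commute open_ball openin_open_Int)

text \<open>The square is embedded in \<open>nat \<Rightarrow> real\<close> to reuse the convex
  test; \<open>S\<close> restricts only the coordinates 0 and 1, and \<open>e\<close> fills the
  remaining ones with the second component.\<close>

lemma openin_square_path_test:
  fixes U :: "(real \<times> real) set"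
  assumes U: "U \<subseteq> {0..1} \<times> {0..1}"
    and test: "\<And>g h. pathin II g \<Longrightarrow> pathin II h \<Longrightarrow> openin II {t \<in> {0..1}. (g t, h t) \<in> U}"
  shows "openin (prod_topology II II) U"
proof -
  define S :: "(nat \<Rightarrow> real) set" where "S = {x. x 0 \<in> {0..1} \<and> x 1 \<in> {0..1}}"
  define e :: "real \<times> real \<Rightarrow> nat \<Rightarrow> real" where "e z i = (if i = 0 then fst z else snd z)" for z i
  have "openin (top_of_set S) {x \<in> S. (x 0, x 1) \<in> U}"
  proof (rule openin_convex_path_test)
    fix x y and c :: real assume "x \<in> S" "y \<in> S" "c \<in> {0..1}"
    then show "(\<lambda>i. (1 - c) * x i + c * y i) \<in> S"
      by (auto simp: S_def intro!: convex_bound_le)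
  next
    fix g assume g: "pathin (top_of_set S) g"
    have "continuous_map (top_of_set S) II (\<lambda>x. x i)" if "i = 0 \<or> i = 1" for i
      using that by (auto simp: S_def intro: continuous_on_subset[OF continuous_on_product_coordinates])
    from pathin_compose[OF g this]
    have "pathin II (\<lambda>t. g t 0)" "pathin II (\<lambda>t. g t 1)" by (simp_all add: o_def)
    from test[OF this] have "openin II {t \<in> {0..1}. (g t 0, g t 1) \<in> U}" .
    moreover have "g t \<in> S" if "t \<in> {0..1}" for t
      using g that by (auto simp: pathin_def)
    ultimately show "openin II {t \<in> {0..1}. g t \<in> {x \<in> S. (x 0, x 1) \<in> U}}"
      by (simp cong: conj_cong)
  qed auto
  moreover have "continuous_on ({0..1} \<times> {0..1}) (\<lambda>z. e z i)" for i
    by (cases "i = 0") (auto simp: e_def intro!: continuous_intros)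
  then have "continuous_on ({0..1} \<times> {0..1}) e"
    by (rule continuous_on_coordinatewise_then_product)
  then have "continuous_map (prod_topology II II) (top_of_set S) e"
    by (auto simp: e_def S_def)
  ultimately have "openin (prod_topology II II)
      {z \<in> topspace (prod_topology II II). e z \<in> {x \<in> S. (x 0, x 1) \<in> U}}"
    using openin_continuous_map_preimage by blast
  moreover have "{z \<in> topspace (prod_topology II II). e z \<in> {x \<in> S. (x 0, x 1) \<in> U}} = U"
    using U by (auto simp: e_def S_def)
  ultimately show ?thesis by simp
qed

text \<open>The tube lemma in the form used later: an open condition quantified over a compact
  parameter stays open in the other variable.\<close>

lemma openin_all_compact_left:
  assumes W: "openin (prod_topology X Y) W" and K: "compactin X K"
  shows "openin Y {y \<in> topspace Y. \<forall>x\<in>K. (x, y) \<in> W}"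
proof (subst openin_subopen, intro ballI)
  fix y assume y: "y \<in> {y \<in> topspace Y. \<forall>x\<in>K. (x, y) \<in> W}"
  then obtain U V where "openin Y V" "K \<subseteq> U" "y \<in> V" "U \<times> V \<subseteq> W"
    using tube_lemma_left[OF W K, of y] by blast
  moreover from this have "V \<subseteq> {y \<in> topspace Y. \<forall>x\<in>K. (x, y) \<in> W}"
    using openin_subset by fast
  ultimately show "\<exists>T. openin Y T \<and> y \<in> T \<and> T \<subseteq> {y \<in> topspace Y. \<forall>x\<in>K. (x, y) \<in> W}"
    by blast
qed

lemma openin_all_compact_right:
  assumes W: "openin (prod_topology X Y) W" and K: "compactin Y K"
  shows "openin X {x \<in> topspace X. \<forall>y\<in>K. (x, y) \<in> W}"
proof (subst openin_subopen, intro ballI)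
  fix x assume x: "x \<in> {x \<in> topspace X. \<forall>y\<in>K. (x, y) \<in> W}"
  then obtain U V where "openin X U" "x \<in> U" "K \<subseteq> V" "U \<times> V \<subseteq> W"
    using tube_lemma_right[OF W K, of x] by blast
  moreover from this have "U \<subseteq> {x \<in> topspace X. \<forall>y\<in>K. (x, y) \<in> W}"
    using openin_subset by fast
  ultimately show "\<exists>T. openin X T \<and> x \<in> T \<and> T \<subseteq> {x \<in> topspace X. \<forall>y\<in>K. (x, y) \<in> W}"
    by blast
qed

lemma compactin_II: "compact K \<Longrightarrow> K \<subseteq> {0..1} \<Longrightarrow> compactin II K"
  by (simp add: compactin_subtopology)

lemma pathin_pair:
  "pathin X g \<Longrightarrow> pathin Y h \<Longrightarrow> pathin (prod_topology X Y) (\<lambda>t. (g t, h t))"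
  by (simp add: pathin_def continuous_map_pairedI)

text \<open>A path-open \<open>A\<close> contains a compact segment \<open>J \<times> {z0}\<close>.
  The set \<open>V\<close> of all \<open>z\<close> with \<open>J \<times> {z} \<subseteq> A\<close>
  passes the path test in \<open>Z\<close>: along a path in \<open>Z\<close> the question moves to
  the square, where \<open>openin_square_path_test\<close> and compactness of \<open>J\<close>
  settle it.\<close>

lemma delta_generated_prod_II:
  fixes Z :: "'z topology"
  assumes Z: "delta_generated Z"
  shows "delta_generated (prod_topology II Z)"
  unfolding delta_generated_path_test
proof (intro allI impI)
  fix A :: "(real \<times> 'z) set"
  assume A: "A \<subseteq> topspace (prod_topology II Z) \<and>
    (\<forall>g. pathin (prod_topology II Z) g \<longrightarrow> openin II {t \<in> {0..1}. g t \<in> A})"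
  show "openin (prod_topology II Z) A"
    unfolding openin_prod_topology_alt
  proof (intro allI impI)
    fix r0 z0 assume rz: "(r0, z0) \<in> A"
    then have "r0 \<in> {0..1}" "z0 \<in> topspace Z" using A by auto
    have "pathin (prod_topology II Z) (\<lambda>r. (r, z0))"
      using \<open>z0 \<in> topspace Z\<close> by (intro pathin_pair) (simp_all add: pathin_def)
    then have "openin II {r \<in> {0..1}. (r, z0) \<in> A}" using A by blast
    then obtain \<epsilon> where \<epsilon>: "0 < \<epsilon>" "cball r0 \<epsilon> \<inter> {0..1} \<subseteq> {r \<in> {0..1}. (r, z0) \<in> A}"
      by (rule openin_II_cball) (use rz \<open>r0 \<in> {0..1}\<close> in auto)
    define J where "J = cball r0 \<epsilon> \<inter> {0..1}"
    have J: "compactin II J" by (intro compactin_II) (auto simp: J_def)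
    define V where "V = {z \<in> topspace Z. \<forall>r\<in>J. (r, z) \<in> A}"
    have "openin Z V"
      using Z unfolding delta_generated_path_test
    proof (elim allE impE conjE, intro conjI allI impI)
      fix g assume g: "pathin Z g"
      define B where "B = {(r, t). r \<in> {0..1} \<and> t \<in> {0..1} \<and> (r, g t) \<in> A}"
      have "openin (prod_topology II II) B"
      proof (rule openin_square_path_test)
        fix h1 h2 assume h: "pathin II h1" "pathin II h2"
        have "pathin Z (g \<circ> h2)" using h(2) g unfolding pathin_def by (rule continuous_map_compose)
        from pathin_pair[OF h(1) this]
        have "openin II {t \<in> {0..1}. (h1 t, (g \<circ> h2) t) \<in> A}" using A by blast
        moreover have "h1 t \<in> {0..1}" "h2 t \<in> {0..1}" if "t \<in> {0..1}" for t
          using h that by (auto simp: pathin_def)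
        then have "{t \<in> {0..1}. (h1 t, h2 t) \<in> B} = {t \<in> {0..1}. (h1 t, (g \<circ> h2) t) \<in> A}"
          unfolding B_def by auto
        ultimately show "openin II {t \<in> {0..1}. (h1 t, h2 t) \<in> B}" by simp
      qed (auto simp: B_def)
      from openin_all_compact_left[OF this J]
      have "openin II {t \<in> {0..1}. \<forall>r\<in>J. (r, t) \<in> B}" by simp
      moreover have "{t \<in> {0..1}. \<forall>r\<in>J. (r, t) \<in> B} = {t \<in> {0..1}. g t \<in> V}"
        using path_mem_topspace[OF g] by (auto simp: B_def V_def J_def)
      ultimately show "openin II {t \<in> {0..1}. g t \<in> V}" by simp
    qed (auto simp: V_def)
    moreover have "z0 \<in> V" using \<epsilon>(2) \<open>z0 \<in> topspace Z\<close> by (auto simp: V_def J_def)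
    moreover have "(ball r0 \<epsilon> \<inter> {0..1}) \<times> V \<subseteq> A"
      by (auto simp: V_def J_def)
    ultimately show "\<exists>U V. openin II U \<and> openin Z V \<and> r0 \<in> U \<and> z0 \<in> V \<and> U \<times> V \<subseteq> A"
      using openin_II_ball[of r0 \<epsilon>] \<epsilon>(1) \<open>r0 \<in> {0..1}\<close> by fastforce
  qed
qed

text \<open>
  Path images are closed, so near a point where \<open>f\<close> and \<open>g\<close> differ the image of a small closed
  interval under \<open>f\<close> can be separated from the values of \<open>g\<close>.
\<close>

lemma delta_Hausdorff_openin_neq:
  assumes X: "delta_Hausdorff X" and f: "pathin X f" and g: "pathin X g"
  shows "openin II {t \<in> {0..1}. f t \<noteq> g t}"
proof (subst openin_subopen, intro ballI)
  fix t assume t: "t \<in> {t \<in> {0..1}. f t \<noteq> g t}"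
  then have "g t \<in> topspace X" using path_mem_topspace[OF g] by simp
  then have "pathin X (\<lambda>_. g t)" by (simp add: pathin_def)
  then have "closedin X ((\<lambda>_. g t) ` {0..1::real})" using X unfolding delta_Hausdorff_def by blast
  then have "closedin X {g t}" by (simp add: image_constant_conv)
  then have "openin X (topspace X - {g t})" by blast
  from openin_path_preimage[OF f this]
  obtain \<epsilon> where \<epsilon>: "0 < \<epsilon>" "cball t \<epsilon> \<inter> {0..1} \<subseteq> {s \<in> {0..1}. f s \<in> topspace X - {g t}}"
    by (rule openin_II_cball[of _ t]) (use t path_mem_topspace[OF f] in auto)
  \<comment> \<open>Clamping onto the closed interval around \<open>t\<close> turns the image of
    \<open>f\<close> over that interval into the image of a full path, hence a closed set.\<close>
  define c where "c s = max (max 0 (t - \<epsilon>)) (min (min 1 (t + \<epsilon>)) s)" for s :: real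
  have "pathin II c"
    using \<epsilon>(1) t by (auto simp: pathin_def c_def intro!: continuous_intros)
  from pathin_compose[OF this, of X f] have "pathin X (f \<circ> c)" using f by (simp add: pathin_def)
  then have "closedin X ((f \<circ> c) ` {0..1})" using X unfolding delta_Hausdorff_def by blast
  then have "openin X (topspace X - (f \<circ> c) ` {0..1})" by blast
  from openin_path_preimage[OF g this]
  have o: "openin II ({s \<in> {0..1}. g s \<in> topspace X - (f \<circ> c) ` {0..1}} \<inter> (ball t \<epsilon> \<inter> {0..1}))"
    using openin_II_ball by (rule openin_Int)
  show "\<exists>T. openin II T \<and> t \<in> T \<and> T \<subseteq> {t \<in> {0..1}. f t \<noteq> g t}"
  proof (intro exI conjI)
    have "c s \<in> cball t \<epsilon> \<inter> {0..1}" if "s \<in> {0..1}" for s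
      using \<epsilon>(1) t by (auto simp: c_def dist_real_def)
    then have "f (c s) \<noteq> g t" if "s \<in> {0..1}" for s using \<epsilon>(2) that by blast
    then have "g t \<notin> (f \<circ> c) ` {0..1}" unfolding image_iff comp_apply by metis
    then show "t \<in> {s \<in> {0..1}. g s \<in> topspace X - (f \<circ> c) ` {0..1}} \<inter> (ball t \<epsilon> \<inter> {0..1})"
      using t \<epsilon>(1) path_mem_topspace[OF g] by auto
    have "c s = s" if "s \<in> ball t \<epsilon> \<inter> {0..1}" for s
      using that by (auto simp: c_def dist_real_def)
    then show "{s \<in> {0..1}. g s \<in> topspace X - (f \<circ> c) ` {0..1}} \<inter> (ball t \<epsilon> \<inter> {0..1})
        \<subseteq> {t \<in> {0..1}. f t \<noteq> g t}"
      by (smt (verit) DiffE IntE comp_apply image_eqI mem_Collect_eq subsetI)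
  qed (use o in auto)
qed

section \<open>The compact-open topology\<close>

lemma openin_compact_open_basis:
  assumes "compact K" "K \<subseteq> {0..1}" "openin Y U"
  shows "openin (compact_open_paths Y) {x \<in> paths_of Y. x ` K \<subseteq> U}"
  unfolding compact_open_paths_def
  by (rule topology_generated_by_Basis) (use assms in blast)

text \<open>The empty \<open>K\<close> imposes no condition, so only nonempty \<open>K\<close> need
  be tested; \<open>continuous_map_degenerate\<close> relies on having a point of
  \<open>K\<close>.\<close>

lemma continuous_map_into_compact_open:
  assumes F: "\<And>z. z \<in> topspace Z \<Longrightarrow> F z \<in> paths_of Y"
    and o: "\<And>K U. compact K \<Longrightarrow> K \<subseteq> {0..1} \<Longrightarrow> K \<noteq> {} \<Longrightarrow> openin Y U \<Longrightarrow>
      openin Z {z \<in> topspace Z. F z ` K \<subseteq> U}"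
  shows "continuous_map Z (compact_open_paths Y) F"
  unfolding compact_open_paths_def
proof (rule continuous_on_generated_topo)
  fix W assume "W \<in> {{x \<in> paths_of Y. x ` K \<subseteq> U} |K U. compact K \<and> K \<subseteq> {0..1} \<and> openin Y U}"
  then obtain K U where KU: "compact K" "K \<subseteq> {0..1}" "openin Y U" "W = {x \<in> paths_of Y. x ` K \<subseteq> U}"
    by blast
  have "openin Z {z \<in> topspace Z. F z ` K \<subseteq> U}"
    using o[of K U] KU by (cases "K = {}") auto
  moreover have "F -` W \<inter> topspace Z = {z \<in> topspace Z. F z ` K \<subseteq> U}"
    using F KU(4) by auto
  ultimately show "openin Z (F -` W \<inter> topspace Z)" by simp
next
  have "F ` topspace Z \<subseteq> topspace (compact_open_paths Y)" using F by auto
  then show "F ` topspace Z \<subseteq> \<Union> {{x \<in> paths_of Y. x ` K \<subseteq> U} |K U. compact K \<and> K \<subseteq> {0..1} \<and> openin Y U}"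
    unfolding compact_open_paths_def topology_generated_by_topspace .
qed

text \<open>Local compactness of the interval: \<open>x\<close> maps a whole closed interval around
  \<open>t\<close> into \<open>U\<close>, and that interval is the compact set defining the
  neighbourhood of \<open>x\<close>.\<close>

lemma continuous_map_evaluation:
  "continuous_map (prod_topology (compact_open_paths Y) II) Y (\<lambda>(x, t). x t)"
  unfolding continuous_map_def
proof (intro conjI allI impI)
  show "(\<lambda>(x, t). x t) \<in> topspace (prod_topology (compact_open_paths Y) II) \<rightarrow> topspace Y"
    by (auto simp: paths_of_def path_mem_topspace)
  fix U assume U: "openin Y U"
  show "openin (prod_topology (compact_open_paths Y) II)
      {z \<in> topspace (prod_topology (compact_open_paths Y) II). (case z of (x, t) \<Rightarrow> x t) \<in> U}"
    unfolding openin_prod_topology_alt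
  proof (intro allI impI)
    fix x t
    assume "(x, t) \<in> {z \<in> topspace (prod_topology (compact_open_paths Y) II). (case z of (x, t) \<Rightarrow> x t) \<in> U}"
    then have x: "x \<in> paths_of Y" and t: "t \<in> {0..1}" "x t \<in> U" by auto
    have "pathin Y x" using x by (simp add: paths_of_def)
    from openin_path_preimage[OF this U]
    obtain \<epsilon> where \<epsilon>: "0 < \<epsilon>" "cball t \<epsilon> \<inter> {0..1} \<subseteq> {s \<in> {0..1}. x s \<in> U}"
      by (rule openin_II_cball[of _ t]) (use t in auto)
    define K where "K = cball t \<epsilon> \<inter> {0..1}"
    have "openin (compact_open_paths Y) {x \<in> paths_of Y. x ` K \<subseteq> U}"
      by (rule openin_compact_open_basis) (auto simp: K_def U compact_Int_closed)
    moreover have "x \<in> {x \<in> paths_of Y. x ` K \<subseteq> U}" using x \<epsilon>(2) by (auto simp: K_def)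
    moreover have "{x \<in> paths_of Y. x ` K \<subseteq> U} \<times> (ball t \<epsilon> \<inter> {0..1}) \<subseteq>
        {z \<in> topspace (prod_topology (compact_open_paths Y) II). (case z of (x, t) \<Rightarrow> x t) \<in> U}"
      by (auto simp: K_def image_subset_iff)
    moreover have "t \<in> ball t \<epsilon> \<inter> {0..1}" using t \<epsilon>(1) by simp
    ultimately show "\<exists>V W. openin (compact_open_paths Y) V \<and> openin II W \<and> x \<in> V \<and> t \<in> W \<and>
      V \<times> W \<subseteq> {z \<in> topspace (prod_topology (compact_open_paths Y) II). (case z of (x, t) \<Rightarrow> x t) \<in> U}"
      using openin_II_ball by blast
  qed
qed

lemma continuous_map_uncurry:
  assumes "continuous_map Z (compact_open_paths Y) F" "continuous_map Z II \<phi>"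
  shows "continuous_map Z Y (\<lambda>z. F z (\<phi> z))"
proof -
  have "continuous_map Z (prod_topology (compact_open_paths Y) II) (\<lambda>z. (F z, \<phi> z))"
    using assms by (rule continuous_map_pairedI)
  from continuous_map_compose[OF this continuous_map_evaluation] show ?thesis
    by (simp add: o_def)
qed

lemma continuous_map_curry:
  assumes F: "\<And>z. z \<in> topspace Z \<Longrightarrow> F z \<in> paths_of Y"
    and c: "continuous_map (prod_topology Z II) Y (\<lambda>(z, t). F z t)"
  shows "continuous_map Z (compact_open_paths Y) F"
proof (rule continuous_map_into_compact_open[OF F])
  fix K U assume K: "compact K" "K \<subseteq> {0..1::real}" and U: "openin Y U"
  define W where "W = {z \<in> topspace (prod_topology Z II). (case z of (z, t) \<Rightarrow> F z t) \<in> U}"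
  have "openin (prod_topology Z II) W"
    unfolding W_def using c U by (rule openin_continuous_map_preimage)
  from openin_all_compact_right[OF this compactin_II[OF K]]
  have "openin Z {z \<in> topspace Z. \<forall>t\<in>K. (z, t) \<in> W}" .
  moreover have "{z \<in> topspace Z. \<forall>t\<in>K. (z, t) \<in> W} = {z \<in> topspace Z. F z ` K \<subseteq> U}"
    using K by (auto simp: W_def)
  ultimately show "openin Z {z \<in> topspace Z. F z ` K \<subseteq> U}" by simp
qed auto

text \<open>
  Continuity at the points where the reparametrization degenerates: there the path is constant,
  and nearby values stay inside the image of a continuous family of paths.
\<close>

lemma continuous_map_degenerate:
  assumes F: "\<And>z. z \<in> topspace Z \<Longrightarrow> F z \<in> paths_of Y"
    and A: "openin Z A" and FA: "continuous_map (subtopology Z A) (compact_open_paths Y) F"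
    and G: "continuous_map Z (compact_open_paths Y) G"
    and im: "\<And>z. z \<in> topspace Z \<Longrightarrow> F z ` {0..1} \<subseteq> G z ` {0..1}"
    and const: "\<And>z. z \<in> topspace Z - A \<Longrightarrow> G z constant_on {0..1}"
  shows "continuous_map Z (compact_open_paths Y) F"
proof (rule continuous_map_into_compact_open[OF F])
  fix K U assume K: "compact K" "K \<subseteq> {0..1::real}" "K \<noteq> {}" and U: "openin Y U"
  have 1: "openin Z {z \<in> A. F z ` K \<subseteq> U}"
  proof -
    have "openin (subtopology Z A) {z \<in> topspace (subtopology Z A). F z \<in> {x \<in> paths_of Y. x ` K \<subseteq> U}}"
      using FA openin_compact_open_basis[OF K(1,2) U] by (rule openin_continuous_map_preimage)
    moreover have "{z \<in> topspace (subtopology Z A). F z \<in> {x \<in> paths_of Y. x ` K \<subseteq> U}}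
        = {z \<in> A. F z ` K \<subseteq> U}"
      using F openin_subset[OF A] by auto
    ultimately show ?thesis using A by (simp add: openin_open_subtopology)
  qed
  have 2: "openin Z {z \<in> topspace Z. G z ` {0..1} \<subseteq> U}"
  proof -
    have "openin Z {z \<in> topspace Z. G z \<in> {x \<in> paths_of Y. x ` {0..1} \<subseteq> U}}"
      using G openin_compact_open_basis[OF _ _ U] by (rule openin_continuous_map_preimage) auto
    moreover have "G z \<in> paths_of Y" if "z \<in> topspace Z" for z
      using G that by (auto simp: continuous_map_def)
    ultimately show ?thesis by (simp cong: conj_cong)
  qed
  \<comment> \<open>Off \<open>A\<close> the path \<open>G z\<close> is constant, so one value of
    \<open>F z\<close> in \<open>U\<close> puts all of \<open>G z\<close> into \<open>U\<close>;
    conversely, \<open>G z\<close> inside \<open>U\<close> forces \<open>F z\<close> inside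
    \<open>U\<close>. The preimage is thus a union of two open sets.\<close>
  have "{z \<in> topspace Z. F z ` K \<subseteq> U}
      = {z \<in> A. F z ` K \<subseteq> U} \<union> {z \<in> topspace Z. G z ` {0..1} \<subseteq> U}"
  proof (intro equalityI subsetI)
    fix z assume z: "z \<in> {z \<in> topspace Z. F z ` K \<subseteq> U}"
    show "z \<in> {z \<in> A. F z ` K \<subseteq> U} \<union> {z \<in> topspace Z. G z ` {0..1} \<subseteq> U}"
    proof (cases "z \<in> A")
      case False
      obtain k where k: "k \<in> K" using K(3) by blast
      then have "F z k \<in> G z ` {0..1}" "F z k \<in> U" using im[of z] z K(2) by auto
      moreover obtain c where "\<And>t. t \<in> {0..1} \<Longrightarrow> G z t = c"
        using const[of z] z False by (auto simp: constant_on_def)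
      ultimately have "G z ` {0..1} \<subseteq> U" by auto
      then show ?thesis using z by simp
    qed (use z in simp)
  next
    fix z assume "z \<in> {z \<in> A. F z ` K \<subseteq> U} \<union> {z \<in> topspace Z. G z ` {0..1} \<subseteq> U}"
    then show "z \<in> {z \<in> topspace Z. F z ` K \<subseteq> U}"
      using im[of z] K(2) openin_subset[OF A] by blast
  qed
  then show "openin Z {z \<in> topspace Z. F z ` K \<subseteq> U}"
    using openin_Un[OF 1 2] by simp
qed auto

text \<open>Paths differ as soon as they differ at one time \<open>\<tau>\<close>, so the pairs
  \<open>(r, t)\<close> with \<open>\<gamma> r \<noteq> \<sigma> t\<close> form a union over
  \<open>\<tau>\<close> of open subsets of the square, each open by separation in \<open>Y\<close>.
  Compactness in \<open>r\<close> then opens the set of \<open>t\<close> with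
  \<open>\<sigma> t\<close> off the image of \<open>\<gamma>\<close>.\<close>

lemma delta_Hausdorff_kdelta_compact_open:
  assumes Y: "delta_Hausdorff Y"
  shows "delta_Hausdorff (kdelta (subtopology (compact_open_paths Y) S))"
  unfolding delta_Hausdorff_def pathin_kdelta
proof (intro allI impI)
  let ?Q = "subtopology (compact_open_paths Y) S"
  fix \<gamma> assume \<gamma>: "pathin ?Q \<gamma>"
  have ext: "h t \<in> paths_of Y" if "pathin ?Q h" "t \<in> {0..1}" for h t
    using path_mem_topspace[OF that] by simp
  have eval: "pathin Y (\<lambda>s. h s \<tau>)" if "pathin ?Q h" "\<tau> \<in> {0..1}" for h \<tau>
    unfolding pathin_def
    by (rule continuous_map_uncurry) (use that in \<open>auto simp: pathin_def continuous_map_in_subtopology\<close>)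
  have "openin (kdelta ?Q) (topspace ?Q - \<gamma> ` {0..1})"
    unfolding openin_kdelta_path
  proof (intro conjI allI impI)
    fix \<sigma> assume \<sigma>: "pathin ?Q \<sigma>"
    define W where "W \<tau> = {(r, t). r \<in> {0..1} \<and> t \<in> {0..1} \<and> \<gamma> r \<tau> \<noteq> \<sigma> t \<tau>}" for \<tau> :: real
    have "openin (prod_topology II II) (W \<tau>)" if \<tau>: "\<tau> \<in> {0..1}" for \<tau>
    proof (rule openin_square_path_test)
      fix g h assume gh: "pathin II g" "pathin II h"
      have "pathin Y (\<lambda>s. \<gamma> (g s) \<tau>)" "pathin Y (\<lambda>s. \<sigma> (h s) \<tau>)"
        using pathin_compose[OF gh(1), of Y "\<lambda>s. \<gamma> s \<tau>"] pathin_compose[OF gh(2), of Y "\<lambda>s. \<sigma> s \<tau>"]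
          eval[OF \<gamma> \<tau>] eval[OF \<sigma> \<tau>] by (simp_all add: pathin_def o_def)
      from delta_Hausdorff_openin_neq[OF Y this]
      have "openin II {t \<in> {0..1}. \<gamma> (g t) \<tau> \<noteq> \<sigma> (h t) \<tau>}" .
      moreover have "{t \<in> {0..1}. (g t, h t) \<in> W \<tau>} = {t \<in> {0..1}. \<gamma> (g t) \<tau> \<noteq> \<sigma> (h t) \<tau>}"
        using path_mem_topspace[OF gh(1)] path_mem_topspace[OF gh(2)] by (auto simp: W_def)
      ultimately show "openin II {t \<in> {0..1}. (g t, h t) \<in> W \<tau>}" by simp
    qed (auto simp: W_def)
    then have "openin (prod_topology II II) (\<Union>\<tau>\<in>{0..1}. W \<tau>)" by blast
    from openin_all_compact_left[OF this, of "{0..1}"]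
    have "openin II {t \<in> {0..1}. \<forall>r\<in>{0..1}. (r, t) \<in> (\<Union>\<tau>\<in>{0..1}. W \<tau>)}"
      by (simp add: compactin_II del: UN_iff)
    moreover have "{t \<in> {0..1}. \<forall>r\<in>{0..1}. (r, t) \<in> (\<Union>\<tau>\<in>{0..1}. W \<tau>)}
        = {t \<in> {0..1}. \<sigma> t \<in> topspace ?Q - \<gamma> ` {0..1}}"
    proof -
      have "(r, t) \<in> (\<Union>\<tau>\<in>{0..1}. W \<tau>) \<longleftrightarrow> \<gamma> r \<noteq> \<sigma> t" if "r \<in> {0..1}" "t \<in> {0..1}" for r t
      proof -
        have ext2: "\<gamma> r \<in> extensional {0..1}" "\<sigma> t \<in> extensional {0..1}"
          using ext[OF \<gamma> that(1)] ext[OF \<sigma> that(2)] by (simp_all add: paths_of_def)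
        have "\<gamma> r = \<sigma> t" if "\<forall>\<tau>\<in>{0..1}. \<gamma> r \<tau> = \<sigma> t \<tau>"
          by (rule extensionalityI[OF ext2]) (rule bspec[OF that])
        then show ?thesis using that by (auto simp: W_def)
      qed
      then have "{t \<in> {0..1}. \<forall>r\<in>{0..1}. (r, t) \<in> (\<Union>\<tau>\<in>{0..1}. W \<tau>)}
          = {t \<in> {0..1}. \<forall>r\<in>{0..1}. \<gamma> r \<noteq> \<sigma> t}"
        by (auto simp del: UN_iff atLeastAtMost_iff)
      also have "\<dots> = {t \<in> {0..1}. \<sigma> t \<in> topspace ?Q - \<gamma> ` {0..1}}"
      proof (rule Collect_cong, rule conj_cong[OF refl])
        fix t :: real assume "t \<in> {0..1}"
        then have "\<sigma> t \<in> topspace ?Q" by (rule path_mem_topspace[OF \<sigma>])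
        then show "(\<forall>r\<in>{0..1}. \<gamma> r \<noteq> \<sigma> t) = (\<sigma> t \<in> topspace ?Q - \<gamma> ` {0..1})"
          by (simp only: Diff_iff image_iff) metis
      qed
      finally show ?thesis .
    qed
    ultimately show "openin II {t \<in> {0..1}. \<sigma> t \<in> topspace ?Q - \<gamma> ` {0..1}}" by simp
  qed auto
  then show "closedin (kdelta ?Q) (\<gamma> ` {0..1})"
    using path_mem_topspace[OF \<gamma>] by (subst closedin_def) (auto simp del: topspace_subtopology)
qed

section \<open>Polar coordinates on the disk\<close>

lemma disk_eq: "disk n = top_of_set {x. (\<forall>i\<ge>n. x i = 0) \<and> (\<Sum>i<n. x i ^ 2) \<le> 1}"
  unfolding disk_def Euclidean_space_def subtopology_subtopology powertop_real_eq_euclidean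
  by (simp add: Collect_conj_eq)

lemma disk_boundary_eq: "disk_boundary n = top_of_set {x. (\<forall>i\<ge>n. x i = 0) \<and> (\<Sum>i<n. x i ^ 2) = 1}"
  unfolding disk_boundary_def Euclidean_space_def subtopology_subtopology powertop_real_eq_euclidean
  by (simp add: Collect_conj_eq)

lemma delta_generated_disk: "delta_generated (disk n)"
  unfolding delta_generated_path_test disk_eq
proof (intro allI impI, rule openin_convex_path_test)
  fix x y :: "nat \<Rightarrow> real" and c :: real
  assume x: "x \<in> {x. (\<forall>i\<ge>n. x i = 0) \<and> (\<Sum>i<n. x i ^ 2) \<le> 1}"
    and y: "y \<in> {x. (\<forall>i\<ge>n. x i = 0) \<and> (\<Sum>i<n. x i ^ 2) \<le> 1}" and c: "c \<in> {0..1}"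
  have "(\<Sum>i<n. ((1 - c) * x i + c * y i) ^ 2) \<le> (\<Sum>i<n. (1 - c) * x i ^ 2 + c * y i ^ 2)"
  proof (rule sum_mono)
    fix i
    \<comment> \<open>Convexity of squaring, with its exact defect.\<close>
    have "(1 - c) * x i ^ 2 + c * y i ^ 2 - ((1 - c) * x i + c * y i) ^ 2 = c * (1 - c) * (x i - y i) ^ 2"
      by (simp add: power2_eq_square algebra_simps)
    moreover have "0 \<le> c * (1 - c) * (x i - y i) ^ 2" using c by simp
    ultimately show "((1 - c) * x i + c * y i) ^ 2 \<le> (1 - c) * x i ^ 2 + c * y i ^ 2" by linarith
  qed
  also have "\<dots> = (1 - c) * (\<Sum>i<n. x i ^ 2) + c * (\<Sum>i<n. y i ^ 2)"
    by (simp add: sum.distrib sum_distrib_left)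
  also have "\<dots> \<le> 1" by (rule convex_bound_le) (use x y c in auto)
  finally show "(\<lambda>i. (1 - c) * x i + c * y i) \<in> {x. (\<forall>i\<ge>n. x i = 0) \<and> (\<Sum>i<n. x i ^ 2) \<le> 1}"
    using x y by simp
qed auto

lemma compact_space_disk_boundary: "compact_space (disk_boundary n)"
proof -
  define S where "S = {x :: nat \<Rightarrow> real. (\<forall>i\<ge>n. x i = 0) \<and> (\<Sum>i<n. x i ^ 2) = 1}"
  have "compactin (powertop_real UNIV) S"
  proof (rule closed_compactin)
    show "compactin (powertop_real UNIV) (UNIV \<rightarrow>\<^sub>E {-1..1::real})"
      by (simp add: compactin_PiE)
    show "S \<subseteq> UNIV \<rightarrow>\<^sub>E {-1..1::real}"
    proof
      fix x assume x: "x \<in> S"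
      have "\<bar>x i\<bar> \<le> 1" for i
      proof (cases "i < n")
        case True
        then have "x i ^ 2 \<le> (\<Sum>i<n. x i ^ 2)" by (intro member_le_sum) auto
        then show ?thesis using x by (simp add: S_def abs_square_le_1)
      qed (use x in \<open>simp add: S_def\<close>)
      then show "x \<in> UNIV \<rightarrow>\<^sub>E {-1..1::real}" by (auto simp: abs_le_iff minus_le_iff)
    qed
    have "S = (\<Inter>i\<in>{n..}. {x. x i = 0}) \<inter> {x. (\<Sum>i<n. x i ^ 2) = 1}" by (auto simp: S_def)
    moreover have "closed {x :: nat \<Rightarrow> real. x i = 0}" for i
      by (intro closed_Collect_eq continuous_intros) (auto intro: continuous_on_product_coordinates)
    moreover have "closed {x :: nat \<Rightarrow> real. (\<Sum>i<n. x i ^ 2) = 1}"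
      by (intro closed_Collect_eq continuous_intros) (auto intro: continuous_on_product_coordinates)
    ultimately have "closed S" by auto
    then show "closedin (powertop_real UNIV) S" by (simp add: powertop_real_eq_euclidean)
  qed
  then show ?thesis
    by (simp add: disk_boundary_eq S_def powertop_real_eq_euclidean compact_space_subtopology)
qed

text \<open>A continuous surjection from a compact space onto a Hausdorff space. The radius shrinks
  with time, so that time 0 is the boundary sphere, where a lift starts, and time 1 is the
  centre.\<close>

lemma quotient_map_polar:
  assumes "n \<noteq> 0"
  shows "quotient_map (prod_topology II (disk_boundary n)) (disk n) (\<lambda>z i. (1 - fst z) * snd z i)"
proof (rule continuous_imp_quotient_map)
  let ?S = "{x :: nat \<Rightarrow> real. (\<forall>i\<ge>n. x i = 0) \<and> (\<Sum>i<n. x i ^ 2) = 1}"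
  let ?D = "{x :: nat \<Rightarrow> real. (\<forall>i\<ge>n. x i = 0) \<and> (\<Sum>i<n. x i ^ 2) \<le> 1}"
  have sq: "(\<Sum>i<n. (c * e i) ^ 2) = c ^ 2 * (\<Sum>i<n. e i ^ 2)" for c and e :: "nat \<Rightarrow> real"
    by (simp add: power_mult_distrib sum_distrib_left)
  have maps: "(\<lambda>z i. (1 - fst z) * snd z i) \<in> {0..1} \<times> ?S \<rightarrow> ?D"
    by (auto simp: sq power_le_one)
  have "continuous_on ({0..1} \<times> ?S) (\<lambda>z. (1 - fst z) * snd z i)" for i
    by (intro continuous_intros continuous_on_compose2[OF continuous_on_product_coordinates[of i]])
      auto
  then have "continuous_on ({0..1} \<times> ?S) (\<lambda>z i. (1 - fst z) * snd z i)"
    by (rule continuous_on_coordinatewise_then_product)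
  then show "continuous_map (prod_topology II (disk_boundary n)) (disk n) (\<lambda>z i. (1 - fst z) * snd z i)"
    using maps by (auto simp: disk_eq disk_boundary_eq)
  show "compact_space (prod_topology II (disk_boundary n))"
    by (simp add: compact_space_prod_topology compact_space_disk_boundary compact_space_subtopology)
  show "Hausdorff_space (disk n)"
    by (simp add: disk_eq Hausdorff_space_subtopology)
  show "(\<lambda>z i. (1 - fst z) * snd z i) ` topspace (prod_topology II (disk_boundary n)) = topspace (disk n)"
  proof
    show "(\<lambda>z i. (1 - fst z) * snd z i) ` topspace (prod_topology II (disk_boundary n)) \<subseteq> topspace (disk n)"
      using maps by (auto simp: disk_eq disk_boundary_eq)
    show "topspace (disk n) \<subseteq> (\<lambda>z i. (1 - fst z) * snd z i) ` topspace (prod_topology II (disk_boundary n))"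
    proof
      fix x assume "x \<in> topspace (disk n)"
      then have x: "\<And>i. i \<ge> n \<Longrightarrow> x i = 0" "(\<Sum>i<n. x i ^ 2) \<le> 1" by (auto simp: disk_eq)
      define r where "r = sqrt (\<Sum>i<n. x i ^ 2)"
      have r: "0 \<le> r" "r \<le> 1" "r ^ 2 = (\<Sum>i<n. x i ^ 2)"
        using x(2) by (auto simp: r_def sum_nonneg)
      show "x \<in> (\<lambda>z i. (1 - fst z) * snd z i) ` topspace (prod_topology II (disk_boundary n))"
      proof (cases "r = 0")
        case True
        then have "(\<Sum>i<n. x i ^ 2) = 0" using r(3) by simp
        then have "\<forall>i\<in>{..<n}. x i ^ 2 = 0" by (subst (asm) sum_nonneg_eq_0_iff) auto
        then have "x i = 0" for i using x(1)[of i] by (cases "i < n") auto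
        then have "x = (\<lambda>_. 0)" by blast
        \<comment> \<open>The centre needs some unit vector, which exists because
          \<open>n \<noteq> 0\<close>.\<close>
        moreover have "(1, \<lambda>i. if i = 0 then 1 else 0) \<in> {0..1::real} \<times> ?S"
          using assms by (auto simp: if_distrib[of "\<lambda>a. a ^ 2"] cong: if_cong)
        ultimately show ?thesis
          by (intro image_eqI[of _ _ "(1, \<lambda>i. if i = 0 then 1 else 0)"]) (auto simp: disk_boundary_eq)
      next
        case False
        have "(\<lambda>i. x i / r) \<in> ?S"
          using sq[of "1/r" x] r False x(1) by (auto simp: power_divide field_simps)
        then show ?thesis
          using r False
          by (intro image_eqI[of _ _ "(1 - r, \<lambda>i. x i / r)"]) (auto simp: disk_boundary_eq)
      qed
    qed
  qed
qed

text \<open>Comparing norms gives \<open>1 - t = 1 - t'\<close>; away from the centre this factor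
  cancels.\<close>

lemma polar_eq_iff:
  assumes "t \<in> {0..1}" "t' \<in> {0..1}" "e \<in> topspace (disk_boundary n)" "e' \<in> topspace (disk_boundary n)"
    and eq: "(\<lambda>i. (1 - t) * e i) = (\<lambda>i. (1 - t') * e' i)"
  shows "t = t' \<and> (t = 1 \<or> e = e')"
proof -
  have "(\<Sum>i<n. ((1 - t) * e i) ^ 2) = (\<Sum>i<n. ((1 - t') * e' i) ^ 2)"
    using fun_cong[OF eq] by simp
  then have "(1 - t) ^ 2 = (1 - t') ^ 2"
    using assms by (simp add: disk_boundary_eq power_mult_distrib flip: sum_distrib_left)
  then have "1 - t = 1 - t'" by (rule power2_eq_imp_eq) (use assms(1,2) in simp_all)
  then have tt: "t = t'" by simp
  show ?thesis
  proof (cases "t = 1")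
    case False
    have "e = e'"
    proof
      fix i
      have "(1 - t) * e i = (1 - t) * e' i" using fun_cong[OF eq, of i] unfolding tt .
      then show "e i = e' i" using False by simp
    qed
    then show ?thesis using tt by blast
  qed (use tt in simp)
qed

section \<open>The length function of a directed path\<close>

lemma continuous_map_real_criterion:
  fixes f :: "'z \<Rightarrow> real"
  assumes "\<And>z \<epsilon>. z \<in> topspace Z \<Longrightarrow> 0 < \<epsilon> \<Longrightarrow>
    \<exists>U. openin Z U \<and> z \<in> U \<and> (\<forall>z'\<in>U. \<bar>f z' - f z\<bar> < \<epsilon>)"
  shows "continuous_map Z euclideanreal f"
  using assms Met_TC.continuous_map_to_metric[of Z f]
  by (simp add: dist_real_def abs_minus_commute)

section \<open>Reparametrizations of the interval\<close>

lemma Rep_plus_endpoints: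
  assumes "\<phi> \<in> Rep_plus"
  shows "\<phi> 0 = 0" "\<phi> 1 = 1"
proof -
  have m: "mono_on {0..1} \<phi>" and im: "\<phi> ` {0..1} = {0..1}" using assms by (auto simp: Rep_plus_def)
  have "0 \<in> \<phi> ` {0..1}" "1 \<in> \<phi> ` {0..1}" unfolding im by auto
  then obtain a b where ab: "a \<in> {0..1}" "\<phi> a = 0" "b \<in> {0..1}" "\<phi> b = 1"
    by (elim imageE) (rule that, auto)
  have "\<phi> 0 \<in> \<phi> ` {0..1}" "\<phi> 1 \<in> \<phi> ` {0..1}" by auto
  then have "\<phi> 0 \<in> {0..1}" "\<phi> 1 \<in> {0..1}" unfolding im by auto
  moreover have "\<phi> 0 \<le> \<phi> a" by (rule mono_onD[OF m]) (use ab in auto)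
  moreover have "\<phi> b \<le> \<phi> 1" by (rule mono_onD[OF m]) (use ab in auto)
  ultimately show "\<phi> 0 = 0" "\<phi> 1 = 1" using ab by auto
qed

lemma Rep_plus_mem: "\<phi> \<in> Rep_plus \<Longrightarrow> t \<in> {0..1} \<Longrightarrow> \<phi> t \<in> {0..1}"
  by (auto simp: Rep_plus_def)

lemma Rep_plus_subset: "Rep_plus \<subseteq> monotone_selfmaps"
  by (auto simp: Rep_plus_def monotone_selfmaps_def)

lemma Rep_plusI:
  assumes c: "continuous_on {0..1} \<phi>" and m: "mono_on {0..1} \<phi>" and e: "\<phi> 0 = 0" "\<phi> 1 = 1"
  shows "\<phi> \<in> Rep_plus"
proof -
  have "\<phi> ` {0..1} \<subseteq> {0..1}"
    using mono_onD[OF m, of 0] mono_onD[OF m, of _ 1] e by fastforce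
  moreover have "{0..1} \<subseteq> \<phi> ` {0..1}"
  proof
    fix r :: real assume "r \<in> {0..1}"
    then show "r \<in> \<phi> ` {0..1}" using IVT'[of \<phi> 0 r 1] c e by force
  qed
  ultimately show ?thesis using c m by (auto simp: Rep_plus_def)
qed

lemma compose_eq [simp]: "t \<in> {0..1} \<Longrightarrow> compose {0..1} x \<phi> t = x (\<phi> t)"
  by (simp add: compose_def)

lemma compose_image_Rep_plus:
  assumes "\<phi> \<in> Rep_plus" shows "compose {0..1} x \<phi> ` {0..1} = x ` {0..1}"
proof -
  have "compose {0..1} x \<phi> ` {0..1} = x ` \<phi> ` {0..1}" by (simp add: image_image cong: image_cong_simp)
  then show ?thesis using assms by (simp add: Rep_plus_def)
qed

lemma constant_on_image: "x constant_on S \<longleftrightarrow> (\<exists>c. x ` S \<subseteq> {c})"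
  by (auto simp: constant_on_def image_subset_iff)

section \<open>Length of paths in a timed space\<close>

locale normalized_timed_space =
  fixes Tc :: top_choice
    and C :: "'c dspace" and M :: "'m set" and d :: "'m \<Rightarrow> 'm \<Rightarrow> real" and \<iota> :: "'c \<Rightarrow> 'm"
    and eps w :: "nat \<Rightarrow> real" and \<theta> :: "real \<Rightarrow> real"
    and X :: "'a dspace" and p :: "'a \<Rightarrow> 'c"
  assumes data: "normalization_data C M d \<iota> eps w \<theta>"
    and timed: "timed_space Tc X C p"
begin

abbreviation "clocked x \<equiv> \<iota> \<circ> p \<circ> x"
abbreviation "el \<equiv> ell d \<iota> eps w \<theta> p"
abbreviation "lm \<equiv> lam d \<iota> eps w \<theta> p"
abbreviation "N \<equiv> norm_path d \<iota> eps w \<theta> X p"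
abbreviation "CO \<equiv> compact_open_paths (dtop X)"

lemma metric: "Metric_space M d" using data by (simp add: normalization_data_def)

sublocale Metric_space M d by (rule metric)

lemma eps_pos: "0 < eps (Suc n)" and w_pos: "0 < w (Suc n)" and w_summable: "summable (\<lambda>n. w (Suc n))"
  and eps_lim: "eps \<longlonglongrightarrow> 0"
  and \<theta>_cont: "continuous_on {0..} \<theta>" and \<theta>_mono: "strict_mono_on {0..} \<theta>" and \<theta>_0: "\<theta> 0 = 0"
  and \<theta>_range: "\<theta> ` {0..} \<subseteq> {0..<1}"
  using data by (auto simp: normalization_data_def)

lemma \<iota>_inj: "inj_on \<iota> (topspace (dtop C))" and \<iota>_cont: "continuous_map (dtop C) mtopology \<iota>"
  using data by (auto simp: normalization_data_def)

lemma p_cont: "continuous_map (dtop X) (dtop C) p"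
  and p_regular: "x \<in> dpaths X \<Longrightarrow> (p \<circ> x) constant_on {0..1} \<Longrightarrow> x constant_on {0..1}"
  using timed by (auto simp: timed_space_def regular_map_def directed_map_def)

lemma dpaths_paths: "x \<in> dpaths X \<Longrightarrow> x \<in> paths_of (dtop X)"
  and dpaths_compose: "x \<in> dpaths X \<Longrightarrow> \<phi> \<in> monotone_selfmaps \<Longrightarrow> compose {0..1} x \<phi> \<in> dpaths X"
  and dpaths_saturated: "x \<in> paths_of (dtop X) \<Longrightarrow> \<phi> \<in> Rep_plus \<Longrightarrow>
    compose {0..1} x \<phi> \<in> dpaths X \<Longrightarrow> x \<in> dpaths X"
  using timed by (auto simp: timed_space_def directed_space_def saturated_def)

lemma clocked_path: "x \<in> paths_of (dtop X) \<Longrightarrow> pathin mtopology (clocked x)"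
  unfolding paths_of_def pathin_def
  using continuous_map_compose[OF _ continuous_map_compose[OF p_cont \<iota>_cont]]
  by (auto simp: o_assoc)

lemma controlled: "x \<in> paths_of (dtop X) \<Longrightarrow> \<exists>F. controls d (eps (Suc n)) (clocked x) 1 F"
  by (rule path_controlled[OF clocked_path eps_pos])

abbreviation "V n x t \<equiv> Var d (eps (Suc n)) (clocked x) t"

lemma V_nonneg: "x \<in> paths_of (dtop X) \<Longrightarrow> t \<in> {0..1} \<Longrightarrow> 0 \<le> V n x t"
  using controlled by (auto intro: Var_nonneg)

lemma V_mono: "x \<in> paths_of (dtop X) \<Longrightarrow> 0 \<le> s \<Longrightarrow> s \<le> t \<Longrightarrow> t \<le> 1 \<Longrightarrow> V n x s \<le> V n x t"
  using controlled by (auto intro: Var_mono)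

lemma term_bounds:
  assumes "x \<in> paths_of (dtop X)" "t \<in> {0..1}"
  shows "0 \<le> w (Suc n) * \<theta> (V n x t)" "w (Suc n) * \<theta> (V n x t) \<le> w (Suc n)"
proof -
  have "\<theta> (V n x t) \<in> \<theta> ` {0..}" using V_nonneg[OF assms, of n] by simp
  then have "\<theta> (V n x t) \<in> {0..<1}" using \<theta>_range by blast
  then show "0 \<le> w (Suc n) * \<theta> (V n x t)" "w (Suc n) * \<theta> (V n x t) \<le> w (Suc n)"
    using w_pos[of n] by (auto simp: mult_le_cancel_left1)
qed

lemma term_summable:
  assumes "x \<in> paths_of (dtop X)" "t \<in> {0..1}"
  shows "summable (\<lambda>n. w (Suc n) * \<theta> (V n x t))"
  by (rule summable_comparison_test'[OF w_summable, of 0]) (use term_bounds[OF assms] in auto)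

lemma el_eq: "el x t = suminf (\<lambda>n. w (Suc n) * \<theta> (V n x t))"
  by (simp add: ell_def Lfun_def)

lemma \<theta>_le: "0 \<le> a \<Longrightarrow> a \<le> b \<Longrightarrow> \<theta> a \<le> \<theta> b"
  using strict_mono_onD[OF \<theta>_mono, of a b] by (cases "a = b") auto

lemma el_mono:
  assumes x: "x \<in> paths_of (dtop X)" and st: "0 \<le> s" "s \<le> t" "t \<le> 1"
  shows "el x s \<le> el x t"
  unfolding el_eq
proof (rule suminf_le)
  fix n
  have "\<theta> (V n x s) \<le> \<theta> (V n x t)" using V_mono[OF x] V_nonneg[OF x] st by (intro \<theta>_le) auto
  then show "w (Suc n) * \<theta> (V n x s) \<le> w (Suc n) * \<theta> (V n x t)"
    using w_pos[of n] by (intro mult_left_mono) auto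
qed (use term_summable[OF x] st in auto)

lemma el_0 [simp]: "el x 0 = 0"
  by (simp add: el_eq \<theta>_0)

lemma el_nonneg: "x \<in> paths_of (dtop X) \<Longrightarrow> t \<in> {0..1} \<Longrightarrow> 0 \<le> el x t"
  using el_mono[of x 0 t] by simp

text \<open>If the clock reading moves by \<open>?D\<close>, a threshold
  \<open>eps (Suc n) < ?D\<close> makes the variation \<open>V n\<close> increase strictly; strict
  monotonicity of \<open>\<theta>\<close> and positivity of the weight pass this to the sum, no term
  of which decreases.\<close>

lemma el_eq_imp_clocked_const:
  assumes x: "x \<in> paths_of (dtop X)" and st: "0 \<le> s" "s \<le> t" "t \<le> 1" and eq: "el x s = el x t"
    and r: "r \<in> {s..t}"
  shows "clocked x r = clocked x s"
proof (rule ccontr)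
  assume neq: "clocked x r \<noteq> clocked x s"
  have sr: "s < r" using r neq by (cases "s = r") auto
  let ?D = "d (clocked x s) (clocked x r)"
  have "clocked x s \<in> M" "clocked x r \<in> M"
    using path_mem[OF clocked_path[OF x]] r st by auto
  then have "0 < ?D" using neq by simp
  from order_tendstoD(2)[OF eps_lim this] obtain n where n: "eps (Suc n) < ?D"
    unfolding eventually_sequentially by (meson le_SucI order_refl)
  obtain F where "controls d (eps (Suc n)) (clocked x) 1 F" using controlled[OF x] by blast
  from controlsD[OF controls_Var[OF this], of s r]
  have lt: "V n x s < V n x r" using sr r st n by simp
  also have "\<dots> \<le> V n x t" using V_mono[OF x] r st by auto
  finally have strict: "V n x s < V n x t" .
  let ?f = "\<lambda>t n. w (Suc n) * \<theta> (V n x t)"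
  have I: "s \<in> {0..1}" "t \<in> {0..1}" using st by auto
  have "0 \<le> ?f t k - ?f s k" for k
    using \<theta>_le[OF V_nonneg[OF x I(1)] V_mono[OF x st], of k] w_pos[of k] by simp
  moreover have "0 < ?f t n - ?f s n"
    using strict_mono_onD[OF \<theta>_mono _ _ strict] V_nonneg[OF x] I w_pos[of n] by simp
  ultimately have "0 < suminf (\<lambda>n. ?f t n - ?f s n)"
    using suminf_pos_iff[OF summable_diff[OF term_summable[OF x I(2)] term_summable[OF x I(1)]]] by blast
  then show False
    using suminf_diff[OF term_summable[OF x I(2)] term_summable[OF x I(1)]] eq by (simp add: el_eq)
qed

lemma el_const:
  assumes x: "x \<in> paths_of (dtop X)" and const: "x constant_on {0..1}" and t: "t \<in> {0..1}"
  shows "el x t = 0"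
proof -
  obtain c where c: "\<And>s. s \<in> {0..1} \<Longrightarrow> x s = c" using const by (auto simp: constant_on_def)
  have "V n x t = 0" for n
  proof (rule antisym)
    have "clocked x 0 \<in> M" by (rule path_mem[OF clocked_path[OF x]]) simp
    then have "controls d (eps (Suc n)) (clocked x) t (\<lambda>_. 0)"
      using c t eps_pos[of n] by (auto simp: controls_def)
    then show "V n x t \<le> 0" using Var_le t by fastforce
  qed (rule V_nonneg[OF x t])
  then show ?thesis by (simp add: el_eq \<theta>_0)
qed

lemma el_reparam:
  assumes x: "x \<in> paths_of (dtop X)" and \<phi>: "\<phi> \<in> Rep_plus" and t: "t \<in> {0..1}"
  shows "el (compose {0..1} x \<phi>) t = el x (\<phi> t)"
proof -
  have "V n (compose {0..1} x \<phi>) t = V n x (\<phi> t)" for n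
  proof -
    obtain F where F: "controls d (eps (Suc n)) (clocked x) 1 F" using controlled[OF x] by blast
    show ?thesis
    proof (rule Var_reparam[OF _ _ t F])
      show "d (clocked x s) (clocked x s) = 0" if "s \<in> {0..1}" for s
        using path_mem[OF clocked_path[OF x] that] by simp
    qed (use \<phi> in \<open>auto simp: Rep_plus_def eps_pos\<close>)
  qed
  then show ?thesis by (simp add: el_eq)
qed

text \<open>Closeness in the compact-open topology implies uniform closeness of the clock readings.
  \<open>Var_uniformly_close\<close> then compares \<open>x'\<close> with \<open>x\<close> at the
  same time, and \<open>continuous_on_Var\<close> compares two times of \<open>x\<close>.\<close>

lemma V_cont: "continuous_map (prod_topology CO II) euclideanreal (\<lambda>(x, t). V n x t)"
proof (rule continuous_map_real_criterion)
  fix z and \<epsilon> :: real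
  assume z: "z \<in> topspace (prod_topology CO II)" and \<epsilon>: "0 < \<epsilon>"
  obtain x t where xt: "z = (x, t)" "x \<in> paths_of (dtop X)" "t \<in> {0..1}" using z by auto
  note y = clocked_path[OF xt(2)]
  have "0 < \<epsilon>/2" using \<epsilon> by simp
  from Var_uniformly_close[OF y eps_pos this] obtain \<delta> where \<delta>: "0 < \<delta>"
    "\<And>y' t. pathin mtopology y' \<Longrightarrow> (\<And>s. s \<in> {0..1} \<Longrightarrow> d (clocked x s) (y' s) < \<delta>) \<Longrightarrow> t \<in> {0..1} \<Longrightarrow>
       \<bar>Var d (eps (Suc n)) y' t - V n x t\<bar> \<le> \<epsilon>/2"
    by blast
  have "continuous_map (prod_topology CO II) mtopology (\<lambda>z. clocked (fst z) (snd z))"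
    using continuous_map_compose[OF continuous_map_evaluation continuous_map_compose[OF p_cont \<iota>_cont]]
    by (simp add: o_def case_prod_unfold)
  moreover have "continuous_map (prod_topology CO II) mtopology (\<lambda>z. clocked x (snd z))"
    using continuous_map_compose[OF continuous_map_snd[of CO II]] y unfolding pathin_def
    by (fastforce simp: o_def)
  ultimately have D: "continuous_map (prod_topology CO II) euclideanreal
      (\<lambda>z. d (clocked x (snd z)) (clocked (fst z) (snd z)))"
    using continuous_map_mdist[of "prod_topology CO II" Self] by (simp add: mtopology_of_def)
  \<comment> \<open>A whole slice \<open>{x'} \<times> {0..1}\<close> inside \<open>W\<close> means
    uniform \<open>\<delta>\<close>-closeness to \<open>x\<close>, an open condition on
    \<open>x'\<close> by compactness of the interval.\<close>
  define W where "W = {z \<in> topspace (prod_topology CO II). d (clocked x (snd z)) (clocked (fst z) (snd z)) < \<delta>}"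
  have "openin (prod_topology CO II) W"
    using openin_continuous_map_preimage[OF D, of "{..<\<delta>}"] by (simp add: W_def)
  from openin_all_compact_right[OF this, of "{0..1}"]
  have U: "openin CO {x' \<in> topspace CO. \<forall>s\<in>{0..1}. (x', s) \<in> W}" (is "openin CO ?U")
    by (simp add: compactin_II)
  have "continuous_on {0..1} (V n x)" by (rule continuous_on_Var[OF y eps_pos])
  then obtain \<eta> where \<eta>: "0 < \<eta>" "\<And>s. s \<in> {0..1} \<Longrightarrow> dist s t < \<eta> \<Longrightarrow> dist (V n x s) (V n x t) < \<epsilon>/2"
    using xt(3) \<open>0 < \<epsilon>/2\<close> unfolding continuous_on_iff by metis
  show "\<exists>U. openin (prod_topology CO II) U \<and> z \<in> U \<and>
      (\<forall>z'\<in>U. \<bar>(case z' of (x, t) \<Rightarrow> V n x t) - (case z of (x, t) \<Rightarrow> V n x t)\<bar> < \<epsilon>)"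
  proof (intro exI conjI)
    show "openin (prod_topology CO II) (?U \<times> (ball t \<eta> \<inter> {0..1}))"
      using U openin_II_ball by (simp add: openin_prod_Times_iff)
    have "d (clocked x s) (clocked x s) = 0" if "s \<in> {0..1}" for s
      using path_mem[OF y that] by simp
    then show "z \<in> ?U \<times> (ball t \<eta> \<inter> {0..1})"
      using xt \<eta>(1) \<delta>(1) by (auto simp: W_def)
    show "\<forall>z'\<in>?U \<times> (ball t \<eta> \<inter> {0..1}).
        \<bar>(case z' of (x, t) \<Rightarrow> V n x t) - (case z of (x, t) \<Rightarrow> V n x t)\<bar> < \<epsilon>"
    proof
      fix z' assume "z' \<in> ?U \<times> (ball t \<eta> \<inter> {0..1})"
      then obtain x' s where z': "z' = (x', s)" "x' \<in> ?U" "s \<in> {0..1}" "dist s t < \<eta>"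
        by (auto simp: dist_commute)
      have "pathin mtopology (clocked x')" using z'(2) by (intro clocked_path) simp
      then have "\<bar>V n x' s - V n x s\<bar> \<le> \<epsilon>/2"
        by (rule \<delta>(2)) (use z' in \<open>auto simp: W_def\<close>)
      moreover have "\<bar>V n x s - V n x t\<bar> < \<epsilon>/2" using \<eta>(2)[of s] z' by (simp add: dist_real_def)
      ultimately have "\<bar>V n x' s - V n x t\<bar> < \<epsilon>" by linarith
      then show "\<bar>(case z' of (x, t) \<Rightarrow> V n x t) - (case z of (x, t) \<Rightarrow> V n x t)\<bar> < \<epsilon>"
        using xt(1) z'(1) by simp
    qed
  qed
qed

lemma el_cont: "continuous_map (prod_topology CO II) euclideanreal (\<lambda>(x, t). el x t)"
proof -
  let ?P = "prod_topology CO II"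
  let ?f = "\<lambda>n z. w (Suc n) * \<theta> (V n (fst z) (snd z))"
  have sub: "(\<lambda>z. V n (fst z) (snd z)) \<in> topspace ?P \<rightarrow> {0..}" for n
    using V_nonneg by auto
  have "continuous_map ?P euclideanreal (?f n)" for n
  proof -
    have "continuous_map ?P (top_of_set {0..}) (\<lambda>z. V n (fst z) (snd z))"
      using V_cont[of n] sub by (simp add: continuous_map_in_subtopology case_prod_unfold image_subset_iff_funcset)
    moreover have "continuous_map (top_of_set {0..}) euclideanreal \<theta>" using \<theta>_cont by simp
    ultimately have "continuous_map ?P euclideanreal (\<theta> \<circ> (\<lambda>z. V n (fst z) (snd z)))"
      by (rule continuous_map_compose)
    then show ?thesis by (intro continuous_map_real_mult_left) (simp add: o_def)
  qed
  then have "\<forall>\<^sub>F n in sequentially. continuous_map ?P euclideanreal (\<lambda>z. \<Sum>k<n. ?f k z)"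
    by (intro always_eventually allI continuous_map_sum) auto
  moreover have "uniform_limit (topspace ?P) (\<lambda>n z. \<Sum>k<n. ?f k z) (\<lambda>z. suminf (\<lambda>k. ?f k z)) sequentially"
    by (rule Weierstrass_m_test[OF _ w_summable]) (use term_bounds in auto)
  then have "\<forall>\<^sub>F n in sequentially. \<forall>z\<in>topspace ?P. dist (\<Sum>k<n. ?f k z) (suminf (\<lambda>k. ?f k z)) < e"
    if "0 < e" for e
    using that unfolding uniform_limit_iff by blast
  ultimately have "continuous_map ?P euclideanreal (\<lambda>z. suminf (\<lambda>k. ?f k z))"
    using Met_TC.continuous_map_uniform_limit_alt[where F = sequentially and X = ?P
        and f = "\<lambda>n z. \<Sum>k<n. ?f k z" and g = "\<lambda>z. suminf (\<lambda>k. ?f k z)"]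
    by simp
  then show ?thesis by (simp add: el_eq case_prod_unfold)
qed

end

section \<open>Normalized paths\<close>

context normalized_timed_space
begin

lemma dpaths_ext: "x \<in> dpaths X \<Longrightarrow> x \<in> extensional {0..1}"
  using dpaths_paths by (auto simp: paths_of_def)

text \<open>Regularity applied to the restriction of \<open>x\<close> to \<open>{s..t}\<close>.\<close>

lemma clocked_const_imp:
  assumes x: "x \<in> dpaths X" and st: "0 \<le> s" "s \<le> t" "t \<le> 1"
    and const: "\<And>r. r \<in> {s..t} \<Longrightarrow> clocked x r = clocked x s"
  shows "x t = x s"
proof -
  define \<phi> where "\<phi> r = s + (t - s) * r" for r
  have \<phi>st: "\<phi> r \<in> {s..t}" if "r \<in> {0..1}" for r
    using that st mult_left_le[of r "t - s"] by (auto simp: \<phi>_def)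
  have "\<phi> \<in> monotone_selfmaps"
    unfolding monotone_selfmaps_def
  proof (intro CollectI conjI)
    show "continuous_on {0..1} \<phi>" unfolding \<phi>_def by (intro continuous_intros)
    show "mono_on {0..1} \<phi>" using st by (auto simp: mono_on_def \<phi>_def mult_left_mono)
    show "\<phi> ` {0..1} \<subseteq> {0..1}"
    proof
      fix q assume "q \<in> \<phi> ` {0..1}"
      then show "q \<in> {0..1}" using \<phi>st st by fastforce
    qed
  qed
  from dpaths_compose[OF x this] have c: "compose {0..1} x \<phi> \<in> dpaths X" .
  have xX: "x r \<in> topspace (dtop X)" if "r \<in> {0..1}" for r
    using dpaths_paths[OF x] that path_mem_topspace by (auto simp: paths_of_def)
  have pC: "p (x r) \<in> topspace (dtop C)" if "r \<in> {0..1}" for r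
    using p_cont xX[OF that] by (auto simp: continuous_map_def)
  have "(p \<circ> compose {0..1} x \<phi>) constant_on {0..1}"
    unfolding constant_on_def
  proof (intro exI ballI)
    fix r :: real assume r: "r \<in> {0..1}"
    have "\<iota> (p (x (\<phi> r))) = \<iota> (p (x s))" using const[OF \<phi>st[OF r]] by simp
    \<comment> \<open>Injectivity of \<open>\<iota>\<close> brings constancy from the metric space
      back to the clock, where regularity applies.\<close>
    then have "p (x (\<phi> r)) = p (x s)"
      using \<phi>st[OF r] st by (intro inj_onD[OF \<iota>_inj]) (auto intro!: pC)
    then show "(p \<circ> compose {0..1} x \<phi>) r = p (x s)" using r by simp
  qed
  then obtain a where a: "\<And>r. r \<in> {0..1} \<Longrightarrow> compose {0..1} x \<phi> r = a"
    using p_regular[OF c] by (auto simp: constant_on_def)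
  from a[of 0] a[of 1] show ?thesis by (simp add: \<phi>_def)
qed

text \<open>Equal length freezes the clock reading, and a frozen reading freezes the directed
  path.\<close>

lemma el_eq_imp:
  assumes x: "x \<in> dpaths X" and st: "0 \<le> s" "s \<le> t" "t \<le> 1" and eq: "el x s = el x t"
  shows "x s = x t"
  by (rule sym, rule clocked_const_imp[OF x st], rule el_eq_imp_clocked_const[OF dpaths_paths[OF x] st eq])

lemma el_1_eq_0_iff:
  assumes x: "x \<in> dpaths X"
  shows "el x 1 = 0 \<longleftrightarrow> x constant_on {0..1}"
proof
  assume 0: "el x 1 = 0"
  have "x t = x 0" if "t \<in> {0..1}" for t
  proof -
    have "el x t \<le> el x 1" using that by (intro el_mono dpaths_paths[OF x]) auto
    then have "el x 0 = el x t" using 0 el_nonneg[OF dpaths_paths[OF x] that] by simp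
    from el_eq_imp[OF x _ _ _ this] show ?thesis using that by simp
  qed
  then show "x constant_on {0..1}" unfolding constant_on_def by blast
qed (use el_const[OF dpaths_paths[OF x]] in simp)

lemma el_continuous_on:
  assumes "x \<in> paths_of (dtop X)" shows "continuous_on {0..1} (el x)"
proof -
  have "continuous_map II (prod_topology CO II) (\<lambda>t. (x, t))"
    using assms by (intro continuous_map_pairedI) auto
  from continuous_map_compose[OF this el_cont] show ?thesis by (simp add: o_def)
qed

text \<open>
  Interpolates between \<open>lam x\<close> at \<open>t = 0\<close> and the identity at \<open>t = 1\<close>; the denominator vanishes
  only for constant \<open>x\<close> and \<open>t = 0\<close>.
\<close>

definition mix :: "real \<Rightarrow> (real \<Rightarrow> 'a) \<Rightarrow> real \<Rightarrow> real" where
  "mix t x \<tau> = ((1 - t) * el x \<tau> + t * \<tau>) / ((1 - t) * el x 1 + t)"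

abbreviation "mix_den t x \<equiv> (1 - t) * el x 1 + t"

lemma mix_den_nonneg: "x \<in> dpaths X \<Longrightarrow> t \<in> {0..1} \<Longrightarrow> 0 \<le> mix_den t x"
  using el_nonneg[OF dpaths_paths, of x 1] by simp

lemma mix_den_eq_0:
  assumes "x \<in> dpaths X" "t \<in> {0..1}" "mix_den t x = 0"
  shows "t = 0" "x constant_on {0..1}"
proof -
  have nn: "0 \<le> (1 - t) * el x 1" using el_nonneg[OF dpaths_paths, of x 1] assms by simp
  then show "t = 0" using assms by (simp add: add_nonneg_eq_0_iff)
  then show "x constant_on {0..1}" using assms el_1_eq_0_iff[OF assms(1)] by simp
qed

lemma mix_Rep_plus:
  assumes x: "x \<in> dpaths X" and t: "t \<in> {0..1}" and nz: "mix_den t x \<noteq> 0"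
  shows "mix t x \<in> Rep_plus"
proof (rule Rep_plusI)
  note xp = dpaths_paths[OF x]
  have pos: "0 < mix_den t x" using mix_den_nonneg[OF x t] nz by linarith
  show "continuous_on {0..1} (mix t x)"
    unfolding mix_def using nz by (intro continuous_intros el_continuous_on[OF xp]) auto
  show "mono_on {0..1} (mix t x)"
  proof (rule mono_onI)
    fix r s :: real assume rs: "r \<in> {0..1}" "s \<in> {0..1}" "r \<le> s"
    have "(1 - t) * el x r + t * r \<le> (1 - t) * el x s + t * s"
      using rs t by (intro add_mono mult_left_mono el_mono[OF xp]) auto
    then show "mix t x r \<le> mix t x s" unfolding mix_def using pos by (intro divide_right_mono) auto
  qed
  show "mix t x 0 = 0" by (simp add: mix_def)
  show "mix t x 1 = 1" using nz by (simp add: mix_def)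
qed

lemma mix_mem:
  assumes "x \<in> dpaths X" "t \<in> {0..1}" "\<tau> \<in> {0..1}"
  shows "mix t x \<tau> \<in> {0..1}"
proof (cases "mix_den t x = 0")
  \<comment> \<open>Division by zero yields 0, so the degenerate value still lies in the
    interval.\<close>
  case True
  then show ?thesis by (simp add: mix_def)
next
  case False
  from Rep_plus_mem[OF mix_Rep_plus[OF assms(1,2) False] assms(3)] show ?thesis .
qed

lemma mix_1: "mix 1 x \<tau> = \<tau>" by (simp add: mix_def)

lemma mix_0: "\<not> x constant_on {0..1} \<Longrightarrow> mix 0 x = lm x"
  by (auto simp: mix_def lam_def)

lemma lm_Rep_plus:
  assumes x: "x \<in> dpaths X" shows "lm x \<in> Rep_plus"
proof (cases "x constant_on {0..1}")
  case True
  then show ?thesis by (auto simp: lam_def intro!: Rep_plusI mono_onI continuous_intros)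
next
  case False
  then have "mix_den 0 x \<noteq> 0" using el_1_eq_0_iff[OF x] by simp
  from mix_Rep_plus[OF x _ this] show ?thesis using mix_0[OF False] by simp
qed

lemma lm_eq_imp:
  assumes x: "x \<in> dpaths X" and st: "s \<in> {0..1}" "t \<in> {0..1}" and eq: "lm x s = lm x t"
  shows "x s = x t"
proof (cases "x constant_on {0..1}")
  case True
  then show ?thesis using st by (auto simp: constant_on_def)
next
  case False
  then have "el x s = el x t" using eq el_1_eq_0_iff[OF x] by (simp add: lam_def)
  then show ?thesis
  proof (cases "s \<le> t")
    case True
    show ?thesis by (rule el_eq_imp[OF x _ True _ \<open>el x s = el x t\<close>]) (use st in auto)
  next
    case False
    have "x t = x s" by (rule el_eq_imp[OF x _ _ _ \<open>el x s = el x t\<close>[symmetric]]) (use st False in auto)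
    then show ?thesis ..
  qed
qed

text \<open>A continuous surjection of the interval onto itself is a quotient map, so a non-constant
  \<open>x\<close>, taking one value on each fibre of \<open>lm x\<close>, factors through it.
  Surjectivity makes the factor unique, which resolves the \<open>THE\<close>.\<close>

lemma norm_path_spec:
  assumes x: "x \<in> dpaths X"
  shows "N x \<in> paths_of (dtop X) \<and> x = compose {0..1} (N x) (lm x)"
proof (cases "x constant_on {0..1}")
  case True
  have "compose {0..1} x id = x"
    using dpaths_ext[OF x] by (intro extensionalityI[of _ "{0..1}"]) auto
  then show ?thesis using True dpaths_paths[OF x] by (simp add: norm_path_def lam_def)
next
  case False
  have "lm x ` {0..1} = {0..1}" using lm_Rep_plus[OF x] by (simp add: Rep_plus_def)
  then have "quotient_map II II (lm x)"
    using lm_Rep_plus[OF x]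
    by (intro continuous_imp_quotient_map)
      (auto simp: Rep_plus_def compact_space_subtopology Hausdorff_space_subtopology)
  moreover have "continuous_map II (dtop X) x"
    using dpaths_paths[OF x] by (simp add: paths_of_def pathin_def)
  moreover have "x s = x t" if "s \<in> topspace II" "t \<in> topspace II" "lm x s = lm x t" for s t
    by (rule lm_eq_imp[OF x _ _ that(3)]) (use that in auto)
  ultimately obtain g where g: "continuous_map II (dtop X) g" "\<And>t. t \<in> topspace II \<Longrightarrow> g (lm x t) = x t"
    by (rule quotient_map_lift_exists) (assumption | rule that)+
  define y where "y = restrict g {0..1}"
  have y: "y \<in> paths_of (dtop X)"
    unfolding paths_of_def pathin_def y_def by (auto intro: continuous_map_eq[OF g(1)])
  have xy: "x = compose {0..1} y (lm x)"
    using dpaths_ext[OF x] g(2) Rep_plus_mem[OF lm_Rep_plus[OF x]]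
    by (intro extensionalityI[of _ "{0..1}"]) (auto simp: y_def)
  have "\<exists>!y. y \<in> paths_of (dtop X) \<and> x = compose {0..1} y (lm x)"
  proof (intro ex1I conjI)
    fix y' assume y': "y' \<in> paths_of (dtop X) \<and> x = compose {0..1} y' (lm x)"
    show "y' = y"
    proof (rule extensionalityI[of _ "{0..1}"])
      fix r :: real assume "r \<in> {0..1}"
      then obtain t where "t \<in> {0..1}" "r = lm x t" using \<open>lm x ` {0..1} = {0..1}\<close> by (metis imageE)
      then show "y' r = y r" using y' xy by (metis compose_eq)
    qed (use y y' in \<open>auto simp: paths_of_def\<close>)
  qed (use y xy in auto)
  from theI'[OF this] show ?thesis using False by (simp add: norm_path_def)
qed

text \<open>Saturation makes the factor of a directed path directed.\<close>

lemma norm_path_dpaths: "x \<in> dpaths X \<Longrightarrow> N x \<in> dpaths X"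
  using dpaths_saturated[OF _ lm_Rep_plus] norm_path_spec by metis

lemma norm_path_at: "x \<in> dpaths X \<Longrightarrow> t \<in> {0..1} \<Longrightarrow> N x (lm x t) = x t"
  using norm_path_spec by (metis compose_eq)

lemma norm_path_endpoints:
  assumes "x \<in> dpaths X" shows "N x 0 = x 0" "N x 1 = x 1"
  using norm_path_at[OF assms, of 0] norm_path_at[OF assms, of 1]
  by (simp_all add: Rep_plus_endpoints[OF lm_Rep_plus[OF assms]])

lemma norm_path_image:
  assumes "x \<in> dpaths X" shows "N x ` {0..1} = x ` {0..1}"
  using compose_image_Rep_plus[OF lm_Rep_plus[OF assms], of "N x"] norm_path_spec[OF assms] by simp

text \<open>For non-constant \<open>x\<close>, the normalizing map of the composite at
  \<open>t\<close> is \<open>lm x (\<phi> t)\<close>, so both normalized paths take the value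
  \<open>x (\<phi> t)\<close> there, and such points exhaust the interval.\<close>

lemma norm_path_reparam:
  assumes x: "x \<in> dpaths X" and \<phi>: "\<phi> \<in> Rep_plus"
  shows "N (compose {0..1} x \<phi>) = N x"
proof (cases "x constant_on {0..1}")
  case True
  then obtain c where c: "\<And>t. t \<in> {0..1} \<Longrightarrow> x t = c" by (auto simp: constant_on_def)
  have "compose {0..1} x \<phi> = x"
    using c dpaths_ext[OF x] Rep_plus_mem[OF \<phi>] by (intro extensionalityI[of _ "{0..1}"]) auto
  then show ?thesis by simp
next
  case False
  let ?z = "compose {0..1} x \<phi>"
  have z: "?z \<in> dpaths X" using dpaths_compose[OF x] \<phi> Rep_plus_subset by blast
  have im: "?z ` {0..1} = x ` {0..1}" by (rule compose_image_Rep_plus[OF \<phi>])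
  then have nc: "\<not> ?z constant_on {0..1}" using False by (simp add: constant_on_image)
  have lm_z: "lm ?z t = lm x (\<phi> t)" if "t \<in> {0..1}" for t
    using False nc el_reparam[OF dpaths_paths[OF x] \<phi>] that Rep_plus_endpoints[OF \<phi>]
    by (simp add: lam_def)
  show ?thesis
  proof (rule extensionalityI[of _ "{0..1}"])
    fix r :: real assume "r \<in> {0..1}"
    then have "r \<in> lm ?z ` {0..1}" using lm_Rep_plus[OF z] by (simp add: Rep_plus_def)
    then obtain t where t: "t \<in> {0..1}" "r = lm ?z t" by auto
    then have "N ?z r = x (\<phi> t)" using norm_path_at[OF z t(1)] by simp
    also have "\<dots> = N x (lm x (\<phi> t))" using norm_path_at[OF x Rep_plus_mem[OF \<phi> t(1)]] by simp
    finally show "N ?z r = N x r" using t lm_z by simp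
  qed (use dpaths_ext norm_path_dpaths x z in auto)
qed

section \<open>Trace classes and their normal forms\<close>

lemma trace_step: "x \<in> dpaths X \<Longrightarrow> \<phi> \<in> Rep_plus \<Longrightarrow> trace_of X (compose {0..1} x \<phi>) = trace_of X x"
proof -
  assume "x \<in> dpaths X" "\<phi> \<in> Rep_plus"
  then have "reparam_step X x (compose {0..1} x \<phi>)" by (auto simp: reparam_step_def)
  then have e: "equivclp (reparam_step X) x (compose {0..1} x \<phi>)"
    by (rule r_into_equivclp[where r = "reparam_step X"])
  show ?thesis
    unfolding trace_of_def
  proof (intro Collect_cong iffI)
    fix y
    show "equivclp (reparam_step X) x y" if "equivclp (reparam_step X) (compose {0..1} x \<phi>) y"
      by (rule equivclp_trans[OF e that])
    show "equivclp (reparam_step X) (compose {0..1} x \<phi>) y" if "equivclp (reparam_step X) x y"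
      by (rule equivclp_trans[OF equivclp_sym[OF e] that])
  qed
qed

text \<open>\<open>N\<close> is invariant under a generating step in either direction, hence along
  the generated equivalence; directedness travels through the induction because
  \<open>norm_path_reparam\<close> requires it.\<close>

lemma equiv_norm_path:
  assumes "equivclp (reparam_step X) x y" "x \<in> dpaths X"
  shows "y \<in> dpaths X \<and> N y = N x"
  using assms
proof (induction rule: equivclp_induct)
  case (step y z)
  then have "y \<in> dpaths X" "N y = N x" by auto
  from step(2) show ?case
  proof
    assume "reparam_step X y z"
    then show ?thesis
      using step dpaths_compose Rep_plus_subset norm_path_reparam
      by (auto simp: reparam_step_def)
  next
    assume "reparam_step X z y"
    then show ?thesis using step norm_path_reparam by (auto simp: reparam_step_def)
  qed
qed auto

lemma trace_norm_path: "x \<in> dpaths X \<Longrightarrow> trace_of X (N x) = trace_of X x"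
  using trace_step[OF norm_path_dpaths lm_Rep_plus, of x x] norm_path_spec[of x] by simp

text \<open>Forward by \<open>equiv_norm_path\<close>; backward because each path reparametrizes its
  normal form and therefore shares its class.\<close>

lemma trace_eq_iff:
  assumes "x \<in> dpaths X" "y \<in> dpaths X"
  shows "trace_of X x = trace_of X y \<longleftrightarrow> N x = N y"
proof
  assume "trace_of X x = trace_of X y"
  have "y \<in> trace_of X y" by (simp add: trace_of_def)
  also have "\<dots> = trace_of X x" using \<open>trace_of X x = trace_of X y\<close> ..
  finally have "equivclp (reparam_step X) x y" by (simp add: trace_of_def)
  then show "N x = N y" using equiv_norm_path assms by metis
next
  assume "N x = N y"
  then show "trace_of X x = trace_of X y" using trace_norm_path assms by metis
qed

lemma norm_path_idem:
  assumes x: "x \<in> dpaths X" shows "N (N x) = N x"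
  using trace_eq_iff[OF norm_path_dpaths[OF x] x] trace_norm_path[OF x] by blast

text \<open>The path space before \<open>kdelta\<close> is applied; continuity arguments work with
  its compact-open subbasis.\<close>

abbreviation pspace :: "'a \<Rightarrow> 'a \<Rightarrow> (real \<Rightarrow> 'a) topology" where
  "pspace u v \<equiv> subtopology CO {x \<in> dpaths X. x 0 = u \<and> x 1 = v}"

lemma topspace_pspace: "topspace (pspace u v) = {x \<in> dpaths X. x 0 = u \<and> x 1 = v}"
  using dpaths_paths by auto

lemma dipath_space_eq: "dipath_space X u v = kdelta (pspace u v)"
  by (simp add: dipath_space_def)

lemma topspace_dipath_space: "topspace (dipath_space X u v) = {x \<in> dpaths X. x 0 = u \<and> x 1 = v}"
  by (simp only: dipath_space_eq topspace_kdelta topspace_pspace)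

lemma dipath_space_cont: "continuous_map Z (dipath_space X u v) f \<Longrightarrow> continuous_map Z CO f"
  using continuous_map_compose[OF _ continuous_map_kdelta_id, of Z "pspace u v" f]
  by (simp add: dipath_space_eq continuous_map_in_subtopology)

lemma el_1_cont:
  assumes "continuous_map Z CO f" shows "continuous_map Z euclideanreal (\<lambda>z. el (f z) 1)"
proof -
  have "continuous_map Z (prod_topology CO II) (\<lambda>z. (f z, 1))"
    using assms by (intro continuous_map_pairedI) auto
  from continuous_map_compose[OF this el_cont] show ?thesis by (simp add: o_def)
qed

text \<open>Since \<open>lm x\<close> is onto, \<open>N x\<close> maps \<open>K\<close> into
  \<open>U\<close> exactly when every \<open>t\<close> with \<open>lm x t \<in> K\<close> has
  \<open>x t \<in> U\<close>. This avoids inverting \<open>lm x\<close>, which need not be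
  injective, and is open in \<open>x\<close> by compactness. Constant paths are handled by
  \<open>continuous_map_degenerate\<close>, as \<open>N x\<close> and \<open>x\<close> have the same
  image.\<close>

lemma norm_path_cont: "continuous_map (pspace u v) (pspace u v) N"
proof (rule continuous_map_into_subtopology)
  let ?Q = "pspace u v"
  have dp: "x \<in> dpaths X" if "x \<in> topspace ?Q" for x using that by simp
  define A where "A = {x \<in> topspace ?Q. el x 1 \<in> - {0}}"
  have A: "openin ?Q A" unfolding A_def
    by (rule openin_continuous_map_preimage[OF el_1_cont])
      (auto simp: continuous_map_from_subtopology[OF continuous_map_id, unfolded id_def])
  show "continuous_map ?Q CO N"
  proof (rule continuous_map_degenerate[OF _ A])
    show "continuous_map ?Q CO (\<lambda>x. x)"
      using continuous_map_from_subtopology[OF continuous_map_id] by (simp add: id_def)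
    show "N x \<in> paths_of (dtop X)" "N x ` {0..1} \<subseteq> x ` {0..1}" if "x \<in> topspace ?Q" for x
      using norm_path_spec[OF dp[OF that]] norm_path_image[OF dp[OF that]] by simp_all
    show "x constant_on {0..1}" if "x \<in> topspace ?Q - A" for x
      using that el_1_eq_0_iff[OF dp] by (auto simp: A_def)
    show "continuous_map (subtopology ?Q A) CO N"
    proof (rule continuous_map_into_compact_open)
      let ?A = "subtopology ?Q A"
      have topA: "topspace ?A = A" using openin_subset[OF A] by auto
      show "N x \<in> paths_of (dtop X)" if "x \<in> topspace ?A" for x
        using norm_path_spec[OF dp[of x]] that by simp
      fix K U assume K: "compact K" "K \<subseteq> {0..1::real}" and U: "openin (dtop X) U"
      have fst: "continuous_map (prod_topology ?A II) CO fst"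
        by (rule continuous_map_into_fulltopology[OF continuous_map_into_fulltopology[OF continuous_map_fst]])
      have 1: "continuous_map (prod_topology ?A II) (dtop X) (\<lambda>z. fst z (snd z))"
        using fst continuous_map_snd by (rule continuous_map_uncurry)
      have "continuous_map (prod_topology ?A II) (prod_topology CO II) (\<lambda>z. (fst z, snd z))"
        using fst continuous_map_snd by (rule continuous_map_pairedI)
      from continuous_map_compose[OF this el_cont]
      have "continuous_map (prod_topology ?A II) euclideanreal (\<lambda>z. el (fst z) (snd z))"
        by (simp add: o_def case_prod_unfold)
      then have "continuous_map (prod_topology ?A II) euclideanreal (\<lambda>z. el (fst z) (snd z) / el (fst z) 1)"
        by (rule continuous_map_real_divide[OF _ el_1_cont[OF fst]]) (auto simp: A_def)
      then have 2: "continuous_map (prod_topology ?A II) euclideanreal (\<lambda>z. lm (fst z) (snd z))"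
      proof (rule continuous_map_eq)
        fix z assume "z \<in> topspace (prod_topology ?A II)"
        then have "fst z \<in> topspace ?Q" "el (fst z) 1 \<noteq> 0" by (auto simp: A_def)
        then show "el (fst z) (snd z) / el (fst z) 1 = lm (fst z) (snd z)"
          using el_1_eq_0_iff[OF dp] by (simp add: lam_def)
      qed
      \<comment> \<open>The implication from \<open>lm x t \<in> K\<close> to
        \<open>x t \<in> U\<close>, written as a union so that both halves are visibly open;
        \<open>K\<close> is closed.\<close>
      define W where "W = {z \<in> topspace (prod_topology ?A II). fst z (snd z) \<in> U}
        \<union> {z \<in> topspace (prod_topology ?A II). lm (fst z) (snd z) \<in> - K}"
      have "openin (prod_topology ?A II) W"
        unfolding W_def using K compact_imp_closed
        by (intro openin_Un openin_continuous_map_preimage[OF 1 U] openin_continuous_map_preimage[OF 2]) auto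
      from openin_all_compact_right[OF this compactin_II[of "{0..1}"], unfolded topA]
      have "openin ?A {x \<in> A. \<forall>t\<in>{0..1}. (x, t) \<in> W}" by blast
      moreover have "(\<forall>t\<in>{0..1}. (x, t) \<in> W) \<longleftrightarrow> N x ` K \<subseteq> U" if "x \<in> A" for x
      proof -
        have x: "x \<in> dpaths X" by (rule dp) (use that in \<open>simp add: A_def\<close>)
        have "(x, t) \<in> W \<longleftrightarrow> (lm x t \<in> K \<longrightarrow> x t \<in> U)" if "t \<in> {0..1}" for t
        proof -
          have "(x, t) \<in> topspace (prod_topology ?A II)"
            unfolding topspace_prod_topology topA using \<open>x \<in> A\<close> that by simp
          then show ?thesis by (simp add: W_def imp_conv_disj disj_commute del: topspace_prod_topology topspace_subtopology)
        qed
        then have "(\<forall>t\<in>{0..1}. (x, t) \<in> W) \<longleftrightarrow> (\<forall>t\<in>{0..1}. lm x t \<in> K \<longrightarrow> x t \<in> U)"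
          by (rule ball_cong[OF refl])
        also have "\<dots> \<longleftrightarrow> (\<forall>t\<in>{0..1}. lm x t \<in> K \<longrightarrow> N x (lm x t) \<in> U)"
          using norm_path_at[OF x] by simp
        also have "\<dots> \<longleftrightarrow> (\<forall>r\<in>lm x ` {0..1}. r \<in> K \<longrightarrow> N x r \<in> U)" by blast
        also have "lm x ` {0..1} = {0..1}" using lm_Rep_plus[OF x] by (simp add: Rep_plus_def)
        also have "(\<forall>r\<in>{0..1}. r \<in> K \<longrightarrow> N x r \<in> U) \<longleftrightarrow> N x ` K \<subseteq> U" using K by blast
        finally show ?thesis .
      qed
      ultimately show "openin ?A {x \<in> topspace ?A. N x ` K \<subseteq> U}"
        unfolding topA by (simp cong: conj_cong)
    qed
  qed
  show "N \<in> topspace ?Q \<rightarrow> {x \<in> dpaths X. x 0 = u \<and> x 1 = v}"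
    using norm_path_dpaths norm_path_endpoints by auto
qed

lemma norm_path_cont_dipath: "continuous_map (dipath_space X u v) (dipath_space X u v) N"
  unfolding dipath_space_eq by (rule continuous_map_kdelta[OF norm_path_cont])

text \<open>The hypothesis \<open>const\<close> covers a vanishing denominator: there
  \<open>mix t x\<close> is not a reparametrization, but on a constant \<open>y\<close> it acts like
  the identity.\<close>

lemma compose_mix_dpaths:
  assumes y: "y \<in> dpaths X" and x: "x \<in> dpaths X" and t: "t \<in> {0..1}"
    and const: "mix_den t x = 0 \<Longrightarrow> y constant_on {0..1}"
  shows "compose {0..1} y (mix t x) \<in> dpaths X"
    "trace_of X (compose {0..1} y (mix t x)) = trace_of X y"
    "compose {0..1} y (mix t x) 0 = y 0" "compose {0..1} y (mix t x) 1 = y 1"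
proof -
  have "\<exists>\<phi>\<in>Rep_plus. compose {0..1} y (mix t x) = compose {0..1} y \<phi>"
  proof (cases "mix_den t x = 0")
    case True
    then have "compose {0..1} y (mix t x) = compose {0..1} y id"
      using const mix_mem[OF x t]
      by (intro extensionalityI[of _ "{0..1}"]) (auto simp: constant_on_def)
    moreover have "id \<in> Rep_plus" by (auto intro!: Rep_plusI mono_onI continuous_intros)
    ultimately show ?thesis by blast
  qed (use mix_Rep_plus[OF x t] in blast)
  then obtain \<phi> where \<phi>: "\<phi> \<in> Rep_plus" "compose {0..1} y (mix t x) = compose {0..1} y \<phi>" by blast
  show "compose {0..1} y (mix t x) \<in> dpaths X" "trace_of X (compose {0..1} y (mix t x)) = trace_of X y"
    "compose {0..1} y (mix t x) 0 = y 0" "compose {0..1} y (mix t x) 1 = y 1"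
    unfolding \<phi>(2) using dpaths_compose[OF y] \<phi>(1) Rep_plus_subset trace_step[OF y \<phi>(1)]
      Rep_plus_endpoints[OF \<phi>(1)] by auto
qed

text \<open>Where the denominator is nonzero, joint continuity of \<open>mix\<close> and currying
  suffice. Elsewhere \<open>F z\<close> is constant and serves as the enclosing family in
  \<open>continuous_map_degenerate\<close>.\<close>

lemma compose_mix_cont:
  fixes Z :: "'z topology"
  assumes F: "continuous_map Z CO F" and f: "continuous_map Z CO f" and T: "continuous_map Z II T"
    and Fd: "\<And>z. z \<in> topspace Z \<Longrightarrow> F z \<in> dpaths X" and fd: "\<And>z. z \<in> topspace Z \<Longrightarrow> f z \<in> dpaths X"
    and const: "\<And>z. z \<in> topspace Z \<Longrightarrow> mix_den (T z) (f z) = 0 \<Longrightarrow> F z constant_on {0..1}"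
  shows "continuous_map Z CO (\<lambda>z. compose {0..1} (F z) (mix (T z) (f z)))"
proof -
  have T01: "T z \<in> {0..1}" if "z \<in> topspace Z" for z
    using T that by (auto simp: continuous_map_def)
  have TR: "continuous_map Z euclideanreal T" using T by (rule continuous_map_into_fulltopology)
  define A where "A = {z \<in> topspace Z. mix_den (T z) (f z) \<in> - {0}}"
  have den: "continuous_map Z euclideanreal (\<lambda>z. mix_den (T z) (f z))"
    by (intro continuous_map_add continuous_map_real_mult continuous_map_diff el_1_cont f TR)
      auto
  have A: "openin Z A" unfolding A_def by (rule openin_continuous_map_preimage[OF den]) auto
  have mem: "compose {0..1} (F z) (mix (T z) (f z)) \<in> paths_of (dtop X)" if "z \<in> topspace Z" for z
    using that compose_mix_dpaths(1)[OF Fd fd T01 const] dpaths_paths by blast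
  show ?thesis
  proof (rule continuous_map_degenerate[OF mem A _ F])
    show "compose {0..1} (F z) (mix (T z) (f z)) ` {0..1} \<subseteq> F z ` {0..1}" if "z \<in> topspace Z" for z
      using mix_mem[OF fd[OF that] T01[OF that]] by auto
    show "F z constant_on {0..1}" if "z \<in> topspace Z - A" for z
      using that const by (auto simp: A_def)
    show "continuous_map (subtopology Z A) CO (\<lambda>z. compose {0..1} (F z) (mix (T z) (f z)))"
    proof (rule continuous_map_curry)
      let ?P = "prod_topology (subtopology Z A) II"
      have lift: "continuous_map ?P Y (\<lambda>q. g (fst q))" if "continuous_map Z Y g" for Y and g :: "'z \<Rightarrow> 'y"
        using continuous_map_compose[OF continuous_map_fst continuous_map_from_subtopology[OF that]]
        by (simp add: o_def)
      have "continuous_map ?P (prod_topology CO II) (\<lambda>q. (f (fst q), snd q))"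
        by (intro continuous_map_pairedI lift[OF f] continuous_map_snd)
      from continuous_map_compose[OF this el_cont]
      have e: "continuous_map ?P euclideanreal (\<lambda>q. el (f (fst q)) (snd q))" by (simp add: o_def)
      have s: "continuous_map ?P euclideanreal snd"
        by (rule continuous_map_into_fulltopology[OF continuous_map_snd])
      have "continuous_map ?P euclideanreal (\<lambda>q. mix (T (fst q)) (f (fst q)) (snd q))"
        unfolding mix_def
        by (intro continuous_map_real_divide continuous_map_add continuous_map_real_mult
            continuous_map_diff lift[OF TR] e s lift[OF den]) (auto simp: A_def)
      then have "continuous_map ?P II (\<lambda>q. mix (T (fst q)) (f (fst q)) (snd q))"
        using mix_mem[OF fd T01] by (auto intro!: continuous_map_into_subtopology)
      then have "continuous_map ?P (dtop X) (\<lambda>q. F (fst q) (mix (T (fst q)) (f (fst q)) (snd q)))"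
        by (rule continuous_map_uncurry[OF lift[OF F]])
      then show "continuous_map ?P (dtop X) (\<lambda>(z, t). compose {0..1} (F z) (mix (T z) (f z)) t)"
        by (rule continuous_map_eq) auto
    qed (use mem in auto)
  qed
qed

end

section \<open>The section of the trace map and lifting\<close>

context normalized_timed_space
begin

lemma topspace_trace_space: "topspace (trace_space X u v) = trace_of X ` topspace (dipath_space X u v)"
  by (simp add: trace_space_def)

lemma trace_section:
  obtains s where "continuous_map (trace_space X u v) (dipath_space X u v) s"
    "\<And>x. x \<in> topspace (dipath_space X u v) \<Longrightarrow> s (trace_of X x) = N x"
proof -
  have "N x = N y" if "x \<in> topspace (dipath_space X u v)" "y \<in> topspace (dipath_space X u v)"
    "trace_of X x = trace_of X y" for x y
    using that trace_eq_iff unfolding topspace_dipath_space by blast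
  with quotient_map_quotient_topology norm_path_cont_dipath show ?thesis
    by (rule quotient_map_lift_exists) (assumption | rule that[unfolded trace_space_def])+
qed

context
  fixes u v s
  assumes s_cont: "continuous_map (trace_space X u v) (dipath_space X u v) s"
    and s_trace: "\<And>x. x \<in> topspace (dipath_space X u v) \<Longrightarrow> s (trace_of X x) = N x"
begin

abbreviation "P \<equiv> dipath_space X u v"
abbreviation "T \<equiv> trace_space X u v"
abbreviation "q \<equiv> trace_of X"

lemma q_cont: "continuous_map P T q"
  unfolding trace_space_def by (rule quotient_imp_continuous_map[OF quotient_map_quotient_topology])

lemma P_dpaths: "x \<in> topspace P \<Longrightarrow> x \<in> dpaths X"
  by (simp add: topspace_dipath_space)

lemma s_mem: "c \<in> topspace T \<Longrightarrow> s c \<in> topspace P"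
  using s_cont by (auto simp: continuous_map_def)

lemma q_s: "c \<in> topspace T \<Longrightarrow> q (s c) = c"
  by (auto simp: topspace_trace_space s_trace trace_norm_path P_dpaths)

lemma homeomorphic_normalized:
  "homeomorphic_map (normalized_space d \<iota> eps w \<theta> X p u v) T q"
  unfolding homeomorphic_map_maps homeomorphic_maps_def normalized_space_def
proof (intro exI[of _ s] conjI ballI)
  show "continuous_map (subtopology P (N ` topspace P)) T q"
    by (rule continuous_map_from_subtopology[OF q_cont])
  show "continuous_map T (subtopology P (N ` topspace P)) s"
    by (rule continuous_map_into_subtopology[OF s_cont])
      (auto simp: topspace_trace_space s_trace)
  show "s (q x) = x" if "x \<in> topspace (subtopology P (N ` topspace P))" for x
  proof -
    have x: "x \<in> topspace P" "x \<in> N ` topspace P" using that by auto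
    then obtain x' where "x' \<in> topspace P" "x = N x'" by blast
    then show ?thesis using s_trace[OF x(1)] norm_path_idem[OF P_dpaths] by simp
  qed
qed (rule q_s)

lemma lifting:
  fixes Z :: "'z topology"
  assumes f: "continuous_map Z P f" and h: "continuous_map (prod_topology II Z) T h"
    and h0: "\<And>z. z \<in> topspace Z \<Longrightarrow> h (0, z) = q (f z)"
  obtains k where "continuous_map (prod_topology II Z) (pspace u v) k"
    "\<And>z. z \<in> topspace Z \<Longrightarrow> k (0, z) = f z"
    "\<And>t z. t \<in> {0..1} \<Longrightarrow> z \<in> topspace Z \<Longrightarrow> q (k (t, z)) = h (t, z)"
    "\<And>z. z \<in> topspace Z \<Longrightarrow> k (1, z) = s (h (1, z))"
proof -
  define k where "k y = compose {0..1} (s (h y)) (mix (fst y) (f (snd y)))" for y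
  have fP: "f z \<in> topspace P" if "z \<in> topspace Z" for z
    using f that by (auto simp: continuous_map_def)
  note fd = P_dpaths[OF fP]
  have hT: "h y \<in> topspace T" if "y \<in> topspace (prod_topology II Z)" for y
    using h that unfolding continuous_map_def by blast
  have shd: "s (h y) \<in> dpaths X" if "y \<in> topspace (prod_topology II Z)" for y
    using s_mem[OF hT[OF that]] by (rule P_dpaths)
  \<comment> \<open>A vanishing denominator forces time 0 and constant \<open>f (snd y)\<close>;
    then \<open>s (h y)\<close> is the normal form of that path and has the same image.\<close>
  have const: "s (h y) constant_on {0..1}"
    if "y \<in> topspace (prod_topology II Z)" "mix_den (fst y) (f (snd y)) = 0" for y
  proof -
    have z: "snd y \<in> topspace Z" "fst y \<in> {0..1}" using that(1) by auto
    from mix_den_eq_0[OF fd[OF z(1)] z(2) that(2)]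
    have "y = (0, snd y)" "f (snd y) constant_on {0..1}" by (auto simp: prod_eq_iff)
    then have "s (h y) = N (f (snd y))" using h0[OF z(1)] s_trace[OF fP[OF z(1)]] by metis
    then show ?thesis
      using norm_path_image[OF fd[OF z(1)]] \<open>f (snd y) constant_on {0..1}\<close> by (simp add: constant_on_image)
  qed
  have mem: "k y \<in> dpaths X" "q (k y) = h y" "k y 0 = u" "k y 1 = v"
    if y: "y \<in> topspace (prod_topology II Z)" for y
  proof -
    have z: "snd y \<in> topspace Z" "fst y \<in> {0..1}" using y by auto
    show "k y \<in> dpaths X" "q (k y) = h y" "k y 0 = u" "k y 1 = v"
      unfolding k_def
      using compose_mix_dpaths[OF shd[OF y] fd[OF z(1)] z(2) const[OF y]] q_s[OF hT[OF y]]
        s_mem[OF hT[OF y]] by (simp_all add: topspace_dipath_space)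
  qed
  have "continuous_map (prod_topology II Z) CO k"
    unfolding k_def
  proof (rule compose_mix_cont)
    show "continuous_map (prod_topology II Z) CO (\<lambda>y. s (h y))"
      using dipath_space_cont[OF continuous_map_compose[OF h s_cont]] by (simp add: o_def)
    show "continuous_map (prod_topology II Z) CO (\<lambda>y. f (snd y))"
      using continuous_map_compose[OF continuous_map_snd dipath_space_cont[OF f]] by (simp add: o_def)
    show "f (snd y) \<in> dpaths X" if "y \<in> topspace (prod_topology II Z)" for y
      using fd that by auto
  qed (use shd const in \<open>simp_all add: continuous_map_fst\<close>)
  then have "continuous_map (prod_topology II Z) (pspace u v) k"
    by (rule continuous_map_into_subtopology) (use mem in auto)
  moreover have "k (0, z) = f z" if z: "z \<in> topspace Z" for z
  proof -
    have "s (h (0, z)) = N (f z)" using h0[OF z] s_trace[OF fP[OF z]] by simp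
    then have k0: "k (0, z) = compose {0..1} (N (f z)) (mix 0 (f z))" by (simp add: k_def)
    show ?thesis
    proof (cases "f z constant_on {0..1}")
      case False
      then show ?thesis using k0 mix_0[OF False] norm_path_spec[OF fd[OF z]] by simp
    next
      \<comment> \<open>Here \<open>mix 0 (f z)\<close> is degenerate, but precomposition with any
        map into the interval leaves a constant path unchanged.\<close>
      case True
      then obtain c where c: "\<And>t. t \<in> {0..1} \<Longrightarrow> f z t = c" by (auto simp: constant_on_def)
      have "N (f z) = f z" using True by (simp add: norm_path_def)
      then show ?thesis
        unfolding k0 using c mix_mem[OF fd[OF z]] dpaths_ext[OF fd[OF z]]
        by (intro extensionalityI[of _ "{0..1}"]) simp_all
    qed
  qed
  moreover have "q (k (t, z)) = h (t, z)" if "t \<in> {0..1}" "z \<in> topspace Z" for t z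
    using mem(2)[of "(t, z)"] that by simp
  moreover have "k (1, z) = s (h (1, z))" if z: "z \<in> topspace Z" for z
    unfolding k_def using dpaths_ext[OF shd[of "(1, z)"]] z
    by (intro extensionalityI[of _ "{0..1}"]) (simp_all add: mix_1)
  ultimately show ?thesis using that by blast
qed

lemma lifting_homotopy:
  fixes Z :: "'z topology"
  assumes Z: "delta_generated Z" shows "homotopy_lifting Z P T q"
  unfolding homotopy_lifting_def
proof (intro allI impI, elim conjE)
  fix f h
  assume f: "continuous_map Z P f" and h: "continuous_map (prod_topology II Z) T h"
    and h0: "\<forall>z\<in>topspace Z. h (0, z) = q (f z)"
  show "\<exists>k. continuous_map (prod_topology II Z) P k \<and> (\<forall>z\<in>topspace Z. k (0, z) = f z) \<and>
      (\<forall>t\<in>{0..1}. \<forall>z\<in>topspace Z. q (k (t, z)) = h (t, z))"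
  proof (rule lifting[OF f h])
    show "h (0, z) = q (f z)" if "z \<in> topspace Z" for z using h0 that by blast
    fix k
    assume k: "continuous_map (prod_topology II Z) (pspace u v) k"
      "\<And>z. z \<in> topspace Z \<Longrightarrow> k (0, z) = f z"
      "\<And>t z. t \<in> {0..1} \<Longrightarrow> z \<in> topspace Z \<Longrightarrow> q (k (t, z)) = h (t, z)"
    show ?thesis
    proof (intro exI[of _ k] conjI ballI)
      show "continuous_map (prod_topology II Z) P k"
        unfolding dipath_space_eq by (rule continuous_map_into_kdelta[OF delta_generated_prod_II[OF Z] k(1)])
    qed (use k in simp_all)
  qed
qed

lemma delta_generated_P: "delta_generated P" and delta_generated_T: "delta_generated T"
  by (simp_all add: dipath_space_eq trace_space_def delta_generated_quotient_topology)

lemma homotopy_equivalence_q: "homotopy_equivalence P T q"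
  unfolding homotopy_equivalence_def
proof (intro conjI exI[of _ s] q_cont s_cont)
  have "continuous_map (prod_topology II P) T (\<lambda>y. q (snd y))"
    using continuous_map_compose[OF continuous_map_snd q_cont] by (simp add: o_def)
  then show "homotopic_with (\<lambda>_. True) P P (s \<circ> q) id"
  proof (rule lifting[OF continuous_map_id])
    fix k
    assume k: "continuous_map (prod_topology II P) (pspace u v) k"
      "\<And>x. x \<in> topspace P \<Longrightarrow> k (0, x) = id x" "\<And>x. x \<in> topspace P \<Longrightarrow> k (1, x) = s (q (snd (1 :: real, x)))"
    from continuous_map_into_kdelta[OF delta_generated_prod_II[OF delta_generated_P] k(1)]
    have "continuous_map (prod_topology II P) P k" by (simp add: dipath_space_eq)
    then have "homotopic_with (\<lambda>_. True) P P id (s \<circ> q)"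
      using k(2,3) by (subst homotopic_with) auto
    then show ?thesis by (rule homotopic_with_symD)
  qed simp
  show "homotopic_with (\<lambda>_. True) T T (q \<circ> s) id"
    by (rule homotopic_with_equal) (auto simp: q_s intro: continuous_map_compose[OF s_cont q_cont])
qed

lemma delta_Hausdorff_P: "delta_Hausdorff (dtop X) \<Longrightarrow> delta_Hausdorff P"
  unfolding dipath_space_eq by (rule delta_Hausdorff_kdelta_compact_open)

text \<open>The \<open>q\<close>-preimage of the image of \<open>g\<close> equals the
  \<open>N\<close>-preimage of the image of \<open>s \<circ> g\<close>. The latter is closed because
  path images in \<open>P\<close> are and \<open>N\<close> is continuous; a quotient map detects
  closedness on preimages.\<close>

lemma delta_Hausdorff_T:
  assumes "delta_Hausdorff (dtop X)" shows "delta_Hausdorff T"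
  unfolding delta_Hausdorff_def
proof (intro allI impI)
  fix g assume g: "pathin T g"
  have gT: "g t \<in> topspace T" if "t \<in> {0..1}" for t using path_mem_topspace[OF g that] .
  have "pathin P (s \<circ> g)" using g s_cont by (rule pathin_compose)
  then have "closedin P ((s \<circ> g) ` {0..1})"
    using delta_Hausdorff_P[OF assms] unfolding delta_Hausdorff_def by blast
  with norm_path_cont_dipath have "closedin P {x \<in> topspace P. N x \<in> (s \<circ> g) ` {0..1}}"
    by (rule closedin_continuous_map_preimage)
  moreover have "N x \<in> (s \<circ> g) ` {0..1} \<longleftrightarrow> q x \<in> g ` {0..1}" if x: "x \<in> topspace P" for x
  proof
    assume "N x \<in> (s \<circ> g) ` {0..1}"
    then obtain t where t: "t \<in> {0..1}" "N x = s (g t)" by auto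
    have "q x = q (N x)" using trace_norm_path[OF P_dpaths[OF x]] by simp
    also have "\<dots> = g t" using t q_s[OF gT] by simp
    finally show "q x \<in> g ` {0..1}" using t(1) by blast
  next
    assume "q x \<in> g ` {0..1}"
    then obtain t where t: "t \<in> {0..1}" "q x = g t" by auto
    then have "N x = (s \<circ> g) t" using s_trace[OF x] by simp
    then show "N x \<in> (s \<circ> g) ` {0..1}" using t(1) by blast
  qed
  ultimately have "closedin P {x \<in> topspace P. q x \<in> g ` {0..1}}" by (simp cong: conj_cong)
  moreover have "g ` {0..1} \<subseteq> topspace T" using gT by blast
  ultimately show "closedin T (g ` {0..1})"
    using quotient_map_quotient_topology[of P q]
    by (simp add: quotient_map_closedin trace_space_def)
qed

lemma in_Top_PT: "in_Top Tc P" "in_Top Tc T"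
proof -
  have "in_Top Tc (dtop X)" using timed by (simp add: timed_space_def directed_space_def)
  then show "in_Top Tc P" "in_Top Tc T"
    using delta_generated_P delta_generated_T delta_Hausdorff_P delta_Hausdorff_T
    by (cases Tc; simp)+
qed

text \<open>
  The lift over the cylinder on the boundary sphere ends at a constant map, so it factors
  through polar coordinates on the disk.
\<close>

lemma disk_lifting:
  assumes f: "continuous_map (disk_boundary n) P f" and h: "continuous_map (disk n) T h"
    and fh: "\<And>z. z \<in> topspace (disk_boundary n) \<Longrightarrow> q (f z) = h z"
  shows "\<exists>k. continuous_map (disk n) P k \<and> (\<forall>z\<in>topspace (disk_boundary n). k z = f z) \<and>
    (\<forall>z\<in>topspace (disk n). q (k z) = h z)"
proof (cases "n = 0")
  case True
  \<comment> \<open>The boundary is empty for \<open>n = 0\<close>, so the section alone provides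
    the lift.\<close>
  have "continuous_map (disk n) P (s \<circ> h)" using h s_cont by (rule continuous_map_compose)
  moreover have "q ((s \<circ> h) z) = h z" if "z \<in> topspace (disk n)" for z
  proof -
    have "h z \<in> topspace T" using h that by (auto simp: continuous_map_def)
    from q_s[OF this] show ?thesis by simp
  qed
  ultimately show ?thesis using True topspace_disk_boundary_0 by blast
next
  case False
  let ?S = "disk_boundary n"
  define \<pi> :: "real \<times> (nat \<Rightarrow> real) \<Rightarrow> nat \<Rightarrow> real" where "\<pi> z = (\<lambda>i. (1 - fst z) * snd z i)" for z
  have \<pi>: "quotient_map (prod_topology II ?S) (disk n) \<pi>"
    unfolding \<pi>_def by (rule quotient_map_polar[OF False])
  have \<pi>0: "\<pi> (0, e) = e" for e by (simp add: \<pi>_def)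
  have "continuous_map (prod_topology II ?S) T (h \<circ> \<pi>)"
    using quotient_imp_continuous_map[OF \<pi>] h by (rule continuous_map_compose)
  moreover have "(h \<circ> \<pi>) (0, e) = q (f e)" if "e \<in> topspace ?S" for e
    using fh[OF that] by (simp add: \<pi>0)
  ultimately obtain k' where k': "continuous_map (prod_topology II ?S) (pspace u v) k'"
    "\<And>e. e \<in> topspace ?S \<Longrightarrow> k' (0, e) = f e"
    "\<And>t e. t \<in> {0..1} \<Longrightarrow> e \<in> topspace ?S \<Longrightarrow> q (k' (t, e)) = (h \<circ> \<pi>) (t, e)"
    "\<And>e. e \<in> topspace ?S \<Longrightarrow> k' (1, e) = s ((h \<circ> \<pi>) (1, e))"
    by (rule lifting[OF f]) (assumption | rule that)+
  \<comment> \<open>\<open>\<pi>\<close> identifies distinct points only over the centre, at time 1,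
    where \<open>k' (1, e) = s (h (\<pi> (1, e)))\<close> does not depend on
    \<open>e\<close>.\<close>
  have "k' y = k' y'" if y: "y \<in> topspace (prod_topology II ?S)" "y' \<in> topspace (prod_topology II ?S)"
    and eq: "\<pi> y = \<pi> y'" for y y'
  proof -
    obtain t e t' e' where te: "y = (t, e)" "y' = (t', e')" by (cases y, cases y')
    have m: "t \<in> {0..1}" "t' \<in> {0..1}" "e \<in> topspace ?S" "e' \<in> topspace ?S" using y te by auto
    have "t = t' \<and> (t = 1 \<or> e = e')"
      by (rule polar_eq_iff[OF m]) (use eq te in \<open>simp add: \<pi>_def\<close>)
    then show ?thesis
      using k'(4)[OF m(3)] k'(4)[OF m(4)] eq te by auto
  qed
  with \<pi> k'(1) obtain k where k: "continuous_map (disk n) (pspace u v) k"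
    "\<And>y. y \<in> topspace (prod_topology II ?S) \<Longrightarrow> k (\<pi> y) = k' y"
    by (rule quotient_map_lift_exists) (assumption | rule that)+
  have "continuous_map (disk n) P k"
    unfolding dipath_space_eq by (rule continuous_map_into_kdelta[OF delta_generated_disk k(1)])
  moreover have "k z = f z" if "z \<in> topspace ?S" for z
    using k(2)[of "(0, z)"] k'(2)[OF that] that by (simp add: \<pi>0)
  moreover have "q (k z) = h z" if "z \<in> topspace (disk n)" for z
  proof -
    have "z \<in> \<pi> ` topspace (prod_topology II ?S)"
      using quotient_imp_surjective_map[OF \<pi>] that by simp
    then obtain t e where "z = \<pi> (t, e)" "t \<in> {0..1}" "e \<in> topspace ?S" by auto
    then show ?thesis using k(2)[of "(t, e)"] k'(3)[of t e] by simp
  qed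
  ultimately show ?thesis by blast
qed

end

end

theorem theorem5p7:
  fixes Tc :: top_choice
    and C :: "'c dspace" and M :: "'m set" and d :: "'m \<Rightarrow> 'm \<Rightarrow> real" and \<iota> :: "'c \<Rightarrow> 'm"
    and eps w :: "nat \<Rightarrow> real" and \<theta> :: "real \<Rightarrow> real"
    and X :: "'a dspace" and p :: "'a \<Rightarrow> 'c" and u v :: 'a
  assumes "clock Tc C"
    and "normalization_data C M d \<iota> eps w \<theta>"
    and "timed_space Tc X C p"
    and "u \<in> topspace (dtop X)" and "v \<in> topspace (dtop X)"
  shows "homeomorphic_map (normalized_space d \<iota> eps w \<theta> X p u v) (trace_space X u v) (trace_of X) \<and>
    trivial_Hurewicz_fibration Tc TYPE('z) (dipath_space X u v) (trace_space X u v) (trace_of X) \<and>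
    trivial_q_fibration Tc (dipath_space X u v) (trace_space X u v) (trace_of X) \<and>
    (delta_Hausdorff (dtop X) \<longrightarrow> delta_Hausdorff (trace_space X u v))"
proof -
  interpret normalized_timed_space Tc C M d \<iota> eps w \<theta> X p
    using assms(2,3) by unfold_locales
  obtain s where s: "continuous_map (trace_space X u v) (dipath_space X u v) s"
    "\<And>x. x \<in> topspace (dipath_space X u v) \<Longrightarrow> s (trace_of X x) = norm_path d \<iota> eps w \<theta> X p x"
    by (rule trace_section[of u v]) (assumption | rule that)+
  have Top_map: "Top_map Tc (dipath_space X u v) (trace_space X u v) (trace_of X)"
    unfolding Top_map_def using in_Top_PT[OF s] q_cont[OF s] by blast
  \<comment> \<open>Both choices of the category consist of Delta-generated spaces, which is what
    \<open>lifting_homotopy\<close> asks of \<open>Z\<close>.\<close>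
  have "delta_generated Z" if "in_Top Tc Z" for Z :: "'z topology"
    using that by (cases Tc) auto
  then have "Hurewicz_fibration Tc TYPE('z) (dipath_space X u v) (trace_space X u v) (trace_of X)"
    unfolding Hurewicz_fibration_def using Top_map lifting_homotopy[OF s] by blast
  moreover have "trivial_q_fibration Tc (dipath_space X u v) (trace_space X u v) (trace_of X)"
    unfolding trivial_q_fibration_def using Top_map disk_lifting[OF s] by blast
  ultimately show ?thesis
    unfolding trivial_Hurewicz_fibration_def
    using homeomorphic_normalized[OF s] homotopy_equivalence_q[OF s] delta_Hausdorff_T[OF s] by blast
qed

end
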